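(* Let $m$ be a nonnegative integer and $\varphi\in\mathcal{LP}_m$. If $n\ge m+1$, then the monic polynomial $k_n(\varphi)g_n^*$ is the (unique) global minimum of the poset $\left(\mathcal{D}(\varphi,n)[\mathcal{H}_n^0],\preccurlyeq\right)$, where $\mathcal{D}(\varphi,n)[\mathcal{H}_n^0]:=\{\mathcal{D}(\varphi,n)[P] : P\in\mathcal{H}_n^0\}$; that is, $k_n(\varphi)g_n^*$ belongs to this set and $k_n(\varphi)g_n^*\preccurlyeq R$ for every $R$ in this set.
   Context: $\mathcal{H}_n$ denotes the set of monic univariate polynomials of degree $n$ all of whose zeros are real, and $\mathcal{H}_n^0$ is the set of $P\in\mathcal{H}_n$ whose zeros (with multiplicity) have arithmetic mean $0$. $\mathcal{Z}(P)$ is the unordered tuple of zeros of $P$ counted with multiplicity. Spectral order: for unordered real $n$-tuples $X,Y$ write $X\prec Y$ if $\sum_{i=1}^n f(x_i)\le\sum_{i=1}^n f(y_i)$ for every convex $f:\mathbb{R}\to\mathbb{R}$ (equivalently, $X=AY$ as column vectors for some doubly stochastic matrix $A$); for $P,Q\in\mathcal{H}_n$ write $Q\preccurlyeq P$ if $\mathcal{Z}(Q)\prec\mathcal{Z}(P)$. The Laguerre-Pólya class $\mathcal{LP}$ is the set of real entire functions of the form $\varphi(x)=cx^me^{-a^2x^2+bx}\prod_{k=1}^\infty(1-\alpha_kx)e^{\alpha_kx}$ with $a,b,c,\alpha_k\in\mathbb{R}$, $c\ne0$, $m$ a nonnegative integer and $\sum_k\alpha_k^2<\infty$. $\mathcal{LP}_m$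 is the set of $\varphi\in\mathcal{LP}$ having a zero of order exactly $m$ at $0$. With $D=d/dx$ and $\varphi(x)=\sum_k a_kx^k$, put $\varphi(D)[P]=\sum_k a_kP^{(k)}$ for polynomials $P$. For $\varphi\in\mathcal{LP}_m$ and $n\ge m+1$, let $k_n(\varphi)=\left[\binom{n}{m}\varphi^{(m)}(0)\right]^{-1}$ and $\mathcal{D}(\varphi,n)=k_n(\varphi)\varphi(D)$, which maps $\mathcal{H}_n$ into $\mathcal{H}_{n-m}$ (by a classical theorem of Pólya). The $n$-th Appell polynomial associated with $\varphi$ is $g_n^*(x)=\varphi(D)[x^n]$. *)

theory Defs
  imports
    "HOL-Complex_Analysis.Complex_Analysis"
    "HOL-Computational_Algebra.Computational_Algebra"
begin

definition hyp_polys :: "nat \<Rightarrow> real poly set" where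
  "hyp_polys n = {P. lead_coeff P = 1 \<and> degree P = n \<and>
     (\<forall>z::complex. poly (map_poly complex_of_real P) z = 0 \<longrightarrow> z \<in> \<real>)}"

definition hyp_polys0 :: "nat \<Rightarrow> real poly set" where
  "hyp_polys0 n = {P \<in> hyp_polys n. (\<Sum>x\<in>#proots P. x) / real n = 0}"

definition majorized :: "real multiset \<Rightarrow> real multiset \<Rightarrow> bool" where
  "majorized X Y \<longleftrightarrow> size X = size Y \<and>
     (\<forall>f::real \<Rightarrow> real. convex_on UNIV f \<longrightarrow> (\<Sum>x\<in>#X. f x) \<le> (\<Sum>y\<in>#Y. f y))"

definition spectral_le :: "nat \<Rightarrow> real poly \<Rightarrow> real poly \<Rightarrow> bool" where
  "spectral_le n Q P \<longleftrightarrow>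
     Q \<in> hyp_polys n \<and> P \<in> hyp_polys n \<and> majorized (proots Q) (proots P)"

text \<open>
  A real entire function is represented by its extension to the complex plane.
  The sequence \<open>\<alpha>\<close> may contain zeros, which covers finite products.
\<close>

definition laguerre_polya :: "(complex \<Rightarrow> complex) set" where
  "laguerre_polya = {\<phi>. \<phi> holomorphic_on UNIV \<and> (\<forall>x\<in>\<real>. \<phi> x \<in> \<real>) \<and>
     (\<exists>(a::real) (b::real) (c::real) (m::nat) (\<alpha>::nat \<Rightarrow> real).
        c \<noteq> 0 \<and> summable (\<lambda>k. (\<alpha> k)\<^sup>2) \<and>
        (\<forall>z. \<phi> z = of_real c * z ^ m * exp (- of_real (a\<^sup>2) * z\<^sup>2 + of_real b * z) *
               (\<Prod>k. (1 - of_real (\<alpha> k) * z) * exp (of_real (\<alpha> k) * z))))}"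

definition laguerre_polya_ord :: "nat \<Rightarrow> (complex \<Rightarrow> complex) set" where
  "laguerre_polya_ord m = {\<phi> \<in> laguerre_polya. zorder \<phi> 0 = int m}"

text \<open>
  The derivatives at the origin of a real entire function are real, so taking
  the real part below is only a change of type.
\<close>

definition real_deriv0 :: "(complex \<Rightarrow> complex) \<Rightarrow> nat \<Rightarrow> real" where
  "real_deriv0 \<phi> k = Re ((deriv ^^ k) \<phi> 0)"

text \<open>
  With \<open>\<phi>(x) = (\<Sum>k. a\<^sub>k x\<^sup>k)\<close>, the operator \<open>\<phi>(D)\<close> sends \<open>P\<close> to \<open>\<Sum>k. a\<^sub>k P\<^sup>(\<^sup>k\<^sup>)\<close>;
  all terms with \<open>k > degree P\<close> vanish.
\<close>

definition diff_op :: "(complex \<Rightarrow> complex) \<Rightarrow> real poly \<Rightarrow> real poly" where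
  "diff_op \<phi> P = (\<Sum>k\<le>degree P. smult (real_deriv0 \<phi> k / fact k) ((pderiv ^^ k) P))"

definition appell :: "(complex \<Rightarrow> complex) \<Rightarrow> nat \<Rightarrow> real poly" where
  "appell \<phi> n = diff_op \<phi> (monom 1 n)"

definition norm_const :: "nat \<Rightarrow> nat \<Rightarrow> (complex \<Rightarrow> complex) \<Rightarrow> real" where
  "norm_const m n \<phi> = inverse (real (n choose m) * real_deriv0 \<phi> m)"

definition norm_diff_op :: "nat \<Rightarrow> nat \<Rightarrow> (complex \<Rightarrow> complex) \<Rightarrow> real poly \<Rightarrow> real poly" where
  "norm_diff_op m n \<phi> P = smult (norm_const m n \<phi>) (diff_op \<phi> P)"

end

theory Submission
  imports Defs
begin

text \<open>
  For \<open>T = \<beta> - \<alpha> D\<close>, monotonicity of \<open>T\<close> in the spectral order reduces by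
  Hardy--Littlewood--Polya to moving two roots \<open>m - d\<close>, \<open>m + d\<close> symmetrically apart. With \<open>r\<close> the
  product of the other linear factors,
  \<open>T(((t - m)\<^sup>2 - d\<^sup>2) r) = ((t - m)\<^sup>2 - d\<^sup>2) T r - 2 \<alpha> (t - m) r\<close> is interlaced by \<open>(t - m) T r\<close>
  for every \<open>d\<close>, by Laguerre's inequality, and increasing \<open>d\<close> pushes its roots away from \<open>m\<close>.
  Since \<open>\<phi>(D)\<close> is a power of \<open>D\<close> composed with a coefficientwise limit of products of operators
  \<open>1 - \<alpha> D\<close>, it is monotone, too, and \<open>x\<^sup>n\<close> is the least element of mean zero.
\<close>

section \<open>Multisets of real roots\<close>

text \<open>The interlacing polynomial \<open>(t - m) T r\<close> does not involve \<open>d\<close>,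
  so the images for two spreads \<open>d\<close> and \<open>e\<close> are counted against one common
  set of points; this makes their roots comparable although no individual root is tracked.
  Interlacing is kept in discrete form: signs at these points fix the parities of root counts, and
  monotonicity of the counts does the rest.

  The signs can fail to be strict when \<open>r\<close> has multiple roots, \<open>T r\<close>
  vanishes at \<open>m\<close>, or \<open>d = 0\<close>. Such configurations are treated as limits
  of generic ones. This needs closure of majorization under coefficientwise limits, which rests on
  continuity of the roots and of convex functions on the line. The same closure carries the order
  from finite products to the infinite product in \<open>\<phi>\<close>.

  Differentiation lowers the degree, so it is kept out of the class of operators closed under
  products and limits, and is applied \<open>m\<close> times at the end.\<close>

definition root_poly :: "real multiset \<Rightarrow> real poly" where
  "root_poly X = (\<Prod>x\<in>#X. [:- x, 1:])"

lemma root_poly_empty [simp]: "root_poly {#} = 1"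
  by (simp add: root_poly_def)

lemma root_poly_add_mset [simp]: "root_poly (add_mset x X) = [:- x, 1:] * root_poly X"
  by (simp add: root_poly_def)

lemma root_poly_nonzero [simp]: "root_poly X \<noteq> 0"
  by (induction X) (simp_all del: mult_pCons_left)

lemma lead_coeff_root_poly [simp]: "lead_coeff (root_poly X) = 1"
  by (induction X) (simp_all add: lead_coeff_mult del: mult_pCons_left)

lemma degree_root_poly [simp]: "degree (root_poly X) = size X"
  by (induction X) (simp_all add: degree_mult_eq del: mult_pCons_left)

lemma coeff_root_poly_size [simp]: "coeff (root_poly X) (size X) = 1"
  using lead_coeff_root_poly[of X] by simp

lemma proots_root_poly [simp]: "proots (root_poly X) = X"
  by (induction X) (simp_all add: proots_mult del: mult_pCons_left)

lemma poly_root_poly: "poly (root_poly X) t = (\<Prod>x\<in>#X. t - x)"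
  by (induction X) (simp_all add: algebra_simps)

lemma poly_root_poly_eq_0_iff: "poly (root_poly X) t = 0 \<longleftrightarrow> t \<in># X"
  by (induction X) auto

lemma map_poly_of_real_mult:
  "map_poly complex_of_real (p * q) = map_poly complex_of_real p * map_poly complex_of_real q"
  by (rule poly_eqI) (simp add: coeff_mult coeff_map_poly)

lemma map_poly_of_real_diff:
  "map_poly complex_of_real (p - q) = map_poly complex_of_real p - map_poly complex_of_real q"
  by (rule poly_eqI) (simp add: coeff_map_poly)

lemma map_poly_of_real_smult:
  "map_poly complex_of_real (smult c p) = smult (of_real c) (map_poly complex_of_real p)"
  by (rule poly_eqI) (simp add: coeff_map_poly)

lemma map_poly_of_real_pderiv:
  "map_poly complex_of_real (pderiv p) = pderiv (map_poly complex_of_real p)"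
  by (rule poly_eqI) (simp add: coeff_map_poly coeff_pderiv)

lemma poly_map_poly_of_real:
  "poly (map_poly complex_of_real p) (of_real x) = of_real (poly p x)"
  by (induction p) (simp_all add: map_poly_pCons)

lemma poly_map_root_poly:
  "poly (map_poly complex_of_real (root_poly X)) z = (\<Prod>x\<in>#X. z - of_real x)"
  by (induction X)
     (simp_all add: map_poly_of_real_mult map_poly_pCons del: mult_pCons_left)

lemma root_poly_in_hyp_polys: "root_poly X \<in> hyp_polys (size X)"
proof -
  have "z \<in> \<real>" if "(\<Prod>x\<in>#X. z - complex_of_real x) = 0" for z
    using that by (induction X) auto
  thus ?thesis
    by (simp add: hyp_polys_def poly_map_root_poly)
qed

lemma hyp_polys_imp_root_poly:
  assumes "P \<in> hyp_polys n"
  obtains X where "P = root_poly X" "size X = n"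
proof -
  have "\<exists>X. P = root_poly X \<and> size X = n"
    using assms
  proof (induction n arbitrary: P)
    case 0
    hence "lead_coeff P = 1" "degree P = 0"
      by (auto simp: hyp_polys_def)
    hence "P = 1"
      by (auto elim!: degree_eq_zeroE)
    thus ?case
      by (intro exI[of _ "{#}"]) auto
  next
    case (Suc n)
    let ?c = "map_poly complex_of_real"
    have P: "lead_coeff P = 1" "degree P = Suc n" "P \<noteq> 0"
      "\<And>z. poly (?c P) z = 0 \<Longrightarrow> z \<in> \<real>"
      using Suc.prems by (auto simp: hyp_polys_def)
    have "degree (?c P) = Suc n"
      using P by (simp add: degree_map_poly)
    then obtain z where z: "poly (?c P) z = 0"
      using fundamental_theorem_of_algebra[of "?c P"] by (auto simp: constant_degree)
    then obtain x where x: "z = of_real x"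
      using P by (metis Reals_cases)
    hence "poly P x = 0"
      using z by (simp add: poly_map_poly_of_real)
    then obtain Q where Q: "P = [:- x, 1:] * Q"
      by (metis dvdE poly_eq_0_iff_dvd)
    have "Q \<noteq> 0"
      using P Q by auto
    hence "degree Q = n"
      using P(2) Q by (simp add: degree_mult_eq del: mult_pCons_left)
    moreover have "lead_coeff Q = 1"
      using P(1) Q lead_coeff_mult[of "[:-x, 1:]" Q] by (simp del: mult_pCons_left)
    moreover have "z \<in> \<real>" if "poly (?c Q) z = 0" for z
      using P(4)[of z] that unfolding Q map_poly_of_real_mult by simp
    ultimately have "Q \<in> hyp_polys n"
      by (simp add: hyp_polys_def)
    then obtain X where "Q = root_poly X" "size X = n"
      using Suc.IH by blast
    thus ?case
      using Q by (intro exI[of _ "add_mset x X"]) simp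
  qed
  thus thesis
    using that by blast
qed

section \<open>Coefficientwise convergence and continuity of the roots\<close>

text \<open>Differentiation, products and division by linear factors act on coefficients by finite
  formulas, hence this form of convergence. A common degree bound is supplied separately where
  values are compared.\<close>

definition coeffs_tendsto :: "(nat \<Rightarrow> real poly) \<Rightarrow> real poly \<Rightarrow> bool" where
  "coeffs_tendsto P p \<longleftrightarrow> (\<forall>k. (\<lambda>N. coeff (P N) k) \<longlonglongrightarrow> coeff p k)"

lemma coeffs_tendstoD: "coeffs_tendsto P p \<Longrightarrow> (\<lambda>N. coeff (P N) k) \<longlonglongrightarrow> coeff p k"
  by (simp add: coeffs_tendsto_def)

lemma coeffs_tendsto_const: "coeffs_tendsto (\<lambda>N. p) p"
  by (simp add: coeffs_tendsto_def)

lemma coeffs_tendsto_pCons: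
  assumes "a \<longlonglongrightarrow> b" "coeffs_tendsto P p"
  shows   "coeffs_tendsto (\<lambda>N. pCons (a N) (P N)) (pCons b p)"
  using assms by (auto simp: coeffs_tendsto_def coeff_pCons split: nat.splits)

lemma coeffs_tendsto_diff:
  "coeffs_tendsto P p \<Longrightarrow> coeffs_tendsto Q q \<Longrightarrow> coeffs_tendsto (\<lambda>N. P N - Q N) (p - q)"
  by (auto simp: coeffs_tendsto_def intro!: tendsto_intros)

lemma coeffs_tendsto_smult:
  "a \<longlonglongrightarrow> b \<Longrightarrow> coeffs_tendsto P p \<Longrightarrow> coeffs_tendsto (\<lambda>N. smult (a N) (P N)) (smult b p)"
  by (auto simp: coeffs_tendsto_def intro!: tendsto_intros)

lemma coeffs_tendsto_sum:
  "(\<And>i. i \<in> I \<Longrightarrow> coeffs_tendsto (P i) (p i)) \<Longrightarrow>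
     coeffs_tendsto (\<lambda>N. \<Sum>i\<in>I. P i N) (\<Sum>i\<in>I. p i)"
  by (auto simp: coeffs_tendsto_def coeff_sum intro!: tendsto_intros)

lemma coeffs_tendsto_mult:
  "coeffs_tendsto P p \<Longrightarrow> coeffs_tendsto Q q \<Longrightarrow> coeffs_tendsto (\<lambda>N. P N * Q N) (p * q)"
  by (auto simp: coeffs_tendsto_def coeff_mult intro!: tendsto_intros)

lemma coeffs_tendsto_pderiv:
  "coeffs_tendsto P p \<Longrightarrow> coeffs_tendsto (\<lambda>N. pderiv (P N)) (pderiv p)"
  by (auto simp: coeffs_tendsto_def coeff_pderiv intro!: tendsto_intros)

lemma coeffs_tendsto_root_poly_image:
  assumes "\<And>i. i \<in># I \<Longrightarrow> (\<lambda>N. x N i) \<longlonglongrightarrow> y i"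
  shows   "coeffs_tendsto (\<lambda>N. root_poly (image_mset (x N) I)) (root_poly (image_mset y I))"
  using assms
proof (induction I)
  case (add i I)
  have "coeffs_tendsto (\<lambda>N. [:- x N i, 1:]) [:- y i, 1:]"
    using add.prems by (intro coeffs_tendsto_pCons coeffs_tendsto_const tendsto_minus) auto
  thus ?case
    using add by (simp del: mult_pCons_left add: coeffs_tendsto_mult)
qed (simp add: coeffs_tendsto_const)

text \<open>Summing to a bound \<open>n\<close> shared by a whole sequence, rather than to the
  degree of each member, lets limits be taken term by term.\<close>

lemma poly_map_of_real_altdef:
  assumes "degree p \<le> n"
  shows   "poly (map_poly complex_of_real p) z = (\<Sum>i\<le>n. of_real (coeff p i) * z ^ i)"
proof -
  have "degree (map_poly complex_of_real p) \<le> n"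
    using assms by (simp add: degree_map_poly)
  hence "(\<Sum>i\<le>n. of_real (coeff p i) * z ^ i) =
      (\<Sum>i\<le>degree (map_poly complex_of_real p). of_real (coeff p i) * z ^ i)"
    by (intro sum.mono_neutral_right) (auto simp: coeff_eq_0 degree_map_poly)
  thus ?thesis
    by (simp add: poly_altdef coeff_map_poly)
qed

lemma tendsto_poly_map_of_real:
  assumes "coeffs_tendsto P p" "\<And>N. degree (P N) \<le> n" "degree p \<le> n"
  shows   "(\<lambda>N. poly (map_poly complex_of_real (P N)) z) \<longlonglongrightarrow> poly (map_poly complex_of_real p) z"
  using assms
  by (auto simp: poly_map_of_real_altdef[of _ n] coeffs_tendsto_def intro!: tendsto_intros)

lemma tendsto_poly:
  assumes "coeffs_tendsto P p" "\<And>N. degree (P N) \<le> n" "degree p \<le> n"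
  shows   "(\<lambda>N. poly (P N) x) \<longlonglongrightarrow> poly p x"
  using tendsto_poly_map_of_real[OF assms, of "of_real x"]
  by (simp add: poly_map_poly_of_real tendsto_of_real_iff)

lemma prod_mset_ge_power:
  fixes f :: "'a \<Rightarrow> real"
  assumes "\<And>x. x \<in># X \<Longrightarrow> c \<le> f x" "c \<ge> 0"
  shows   "c ^ size X \<le> (\<Prod>x\<in>#X. f x)"
  using assms
proof (induction X)
  case (add x X)
  have "0 \<le> f x"
    using add.prems order_trans[of 0 c "f x"] by auto
  thus ?case
    using add by (auto intro!: mult_mono)
qed simp

lemma abs_prod_mset: "\<bar>\<Prod>x\<in>#X. f x\<bar> = (\<Prod>x\<in>#X. \<bar>f x :: real\<bar>)"
  by (induction X) (auto simp: abs_mult)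

lemma norm_prod_mset: "norm (\<Prod>x\<in>#X. f x :: complex) = (\<Prod>x\<in>#X. norm (f x))"
  by (induction X) (auto simp: norm_mult)

text \<open>Synthetic division from the top: each coefficient of the quotient comes from a
  coefficient of the product and the next higher coefficient of the quotient. The recursion starts
  at \<open>n + 1\<close>, where all quotients have coefficient 0.\<close>

lemma coeffs_tendsto_div_linear:
  assumes "coeffs_tendsto (\<lambda>N. [:- y N, 1:] * Q N) ([:- x, 1:] * q)" "y \<longlonglongrightarrow> x"
    and deg: "\<And>N. degree (Q N) \<le> n" "degree q \<le> n"
  shows   "coeffs_tendsto Q q"
proof -
  have eq: "coeff r k = coeff ([:- a, 1:] * r) (Suc k) + a * coeff r (Suc k)"
    for a k and r :: "real poly"
    by simp
  have "(\<lambda>N. coeff (Q N) k) \<longlonglongrightarrow> coeff q k" if "k \<le> Suc n" for k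
    using that
  proof (induction k rule: inc_induct)
    case base
    have "coeff (Q N) (Suc n) = 0" "coeff q (Suc n) = 0" for N
      using deg by (auto intro!: coeff_eq_0 le_imp_less_Suc)
    thus ?case by simp
  next
    case (step k)
    show ?case
      by (subst eq[of "Q N" k "y N" for N], subst eq[of q k x])
         (intro tendsto_add tendsto_mult step.IH assms(2) coeffs_tendstoD[OF assms(1)])
  qed
  moreover have "(\<lambda>N. coeff (Q N) k) \<longlonglongrightarrow> coeff q k" if "k > n" for k
  proof -
    have "coeff (Q N) k = 0" "coeff q k = 0" for N
      using le_less_trans[OF deg(1) that] le_less_trans[OF deg(2) that] by (auto intro!: coeff_eq_0)
    thus ?thesis by simp
  qed
  ultimately show ?thesis
    unfolding coeffs_tendsto_def by (metis linorder_not_less Suc_n_not_le_n le_SucI not_less)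
qed

text \<open>
  Continuity of the roots: if \<open>x\<close> is a root of the limit, then the root of \<open>root_poly (Y N)\<close>
  nearest to \<open>x\<close> converges to \<open>x\<close>, since its distance to the power \<open>n\<close> is at most
  the value at \<open>x\<close>; divide by the two linear factors and repeat.
\<close>

lemma tendsto_sum_roots:
  fixes f :: "real \<Rightarrow> real"
  assumes f: "continuous_on UNIV f"
    and "coeffs_tendsto (\<lambda>N. root_poly (Y N)) (root_poly X)" "\<And>N. size (Y N) = size X"
  shows   "(\<lambda>N. \<Sum>y\<in>#Y N. f y) \<longlonglongrightarrow> (\<Sum>x\<in>#X. f x)"
  using assms(2,3)
proof (induction X arbitrary: Y)
  case (add x X)
  let ?n = "size (add_mset x X)"
  have "\<exists>y. y \<in># Y N \<and> (\<forall>u\<in>#Y N. \<bar>x - y\<bar> \<le> \<bar>x - u\<bar>)" for N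
  proof -
    have "set_mset (Y N) \<noteq> {}"
      using add.prems(2)[of N] by auto
    thus ?thesis
      using ex_min_if_finite[of "(\<lambda>u. \<bar>x - u\<bar>) ` set_mset (Y N)"]
      by (metis (no_types, lifting) arg_min_if_finite(1) arg_min_least finite_set_mset)
  qed
  then obtain y where y: "\<And>N. y N \<in># Y N" "\<And>N u. u \<in># Y N \<Longrightarrow> \<bar>x - y N\<bar> \<le> \<bar>x - u\<bar>"
    by metis
  have le: "\<bar>x - y N\<bar> ^ ?n \<le> \<bar>poly (root_poly (Y N)) x\<bar>" for N
    using prod_mset_ge_power[of "Y N" "\<bar>x - y N\<bar>" "\<lambda>u. \<bar>x - u\<bar>"] y add.prems(2)[of N]
    by (simp add: poly_root_poly abs_prod_mset)
  have "(\<lambda>N. poly (root_poly (Y N)) x) \<longlonglongrightarrow> poly (root_poly (add_mset x X)) x"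
    using add.prems by (intro tendsto_poly[of _ _ ?n]) (auto simp del: mult_pCons_left root_poly_add_mset)
  hence "(\<lambda>N. \<bar>poly (root_poly (Y N)) x\<bar>) \<longlonglongrightarrow> 0"
    by (intro tendsto_rabs_zero) simp
  hence "(\<lambda>N. \<bar>x - y N\<bar> ^ ?n) \<longlonglongrightarrow> 0"
    by (rule Lim_null_comparison[rotated]) (use le in auto)
  hence "(\<lambda>N. root ?n (\<bar>x - y N\<bar> ^ ?n)) \<longlonglongrightarrow> root ?n 0"
    by (intro tendsto_intros)
  hence "(\<lambda>N. \<bar>x - y N\<bar>) \<longlonglongrightarrow> 0"
    by (simp add: real_root_power_cancel del: power_Suc)
  hence "(\<lambda>N. x - y N) \<longlonglongrightarrow> 0"
    by (simp add: tendsto_rabs_zero_iff)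
  hence "(\<lambda>N. x - (x - y N)) \<longlonglongrightarrow> x - 0"
    by (intro tendsto_intros)
  hence ylim: "y \<longlonglongrightarrow> x"
    by simp
  define Z where "Z N = Y N - {#y N#}" for N
  have YZ: "Y N = add_mset (y N) (Z N)" for N
    using y(1)[of N] by (simp add: Z_def)
  have sz: "size (Z N) = size X" for N
    using add.prems(2)[of N] by (simp add: YZ)
  have "coeffs_tendsto (\<lambda>N. root_poly (Z N)) (root_poly X)"
    by (rule coeffs_tendsto_div_linear[of y _ x _ "size X"])
       (use add.prems(1) ylim sz in \<open>auto simp: YZ simp del: mult_pCons_left\<close>)
  hence "(\<lambda>N. \<Sum>y\<in>#Z N. f y) \<longlonglongrightarrow> (\<Sum>x\<in>#X. f x)"
    by (rule add.IH) (rule sz)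
  moreover have "(\<lambda>N. f (y N)) \<longlonglongrightarrow> f x"
    using f ylim by (auto simp: continuous_on_eq_continuous_at intro: isCont_tendsto_compose)
  ultimately show ?case
    by (simp add: YZ tendsto_add)
qed simp

text \<open>A Hurwitz-type closure with an explicit bound: a monic polynomial of degree
  \<open>n\<close> with real roots has modulus at least \<open>|Im z| ^ n\<close> at
  \<open>z\<close>, so the limit cannot vanish off the real axis. The coefficient at
  \<open>n\<close> stays 1, which keeps the degree from dropping.\<close>

lemma coeffs_tendsto_imp_root_poly:
  assumes "coeffs_tendsto (\<lambda>N. root_poly (Y N)) p" "\<And>N. size (Y N) = n"
  obtains X where "p = root_poly X" "size X = n"
proof -
  have coeff_n: "coeff p n = 1"
    using coeffs_tendstoD[OF assms(1), of n] assms(2) coeff_root_poly_size[of "Y _"]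
    by (simp add: LIMSEQ_const_iff)
  have deg: "degree p \<le> n"
  proof (rule degree_le, intro allI impI)
    fix k assume "n < k"
    hence "coeff (root_poly (Y N)) k = 0" for N
      by (intro coeff_eq_0) (simp add: assms(2))
    thus "coeff p k = 0"
      using coeffs_tendstoD[OF assms(1), of k] by (simp add: LIMSEQ_const_iff)
  qed
  hence deg': "degree p = n"
    using coeff_n by (simp add: le_antisym le_degree)
  have "z \<in> \<real>" if z: "poly (map_poly complex_of_real p) z = 0" for z
  proof (rule ccontr)
    assume "z \<notin> \<real>"
    hence "Im z \<noteq> 0"
      by (simp add: complex_is_Real_iff)
    have "\<bar>Im z\<bar> ^ n \<le> norm (poly (map_poly complex_of_real (root_poly (Y N))) z)" for N
      using prod_mset_ge_power[of "Y N" "\<bar>Im z\<bar>" "\<lambda>u. norm (z - of_real u)"]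
        abs_Im_le_cmod[of "z - of_real _"] assms(2)[of N]
      by (simp add: poly_map_root_poly norm_prod_mset)
    moreover have "(\<lambda>N. norm (poly (map_poly complex_of_real (root_poly (Y N))) z)) \<longlonglongrightarrow>
        norm (poly (map_poly complex_of_real p) z)"
      using assms deg by (intro tendsto_norm tendsto_poly_map_of_real[of _ _ n]) auto
    ultimately have "\<bar>Im z\<bar> ^ n \<le> norm (poly (map_poly complex_of_real p) z)"
      by (intro LIMSEQ_le_const) auto
    moreover have "0 < \<bar>Im z\<bar> ^ n"
      using \<open>Im z \<noteq> 0\<close> by simp
    ultimately show False
      using z by simp
  qed
  hence "p \<in> hyp_polys n"
    using coeff_n deg' by (simp add: hyp_polys_def)
  thus thesis
    using that by (elim hyp_polys_imp_root_poly)
qed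

section \<open>Majorization and transfers\<close>

text \<open>Equal sizes, equal sums and the comparison of these sums for every \<open>t\<close> are
  all that \<open>majorized_transfer_induct\<close> takes from \<open>majorized X Y\<close>. As a
  function of \<open>t\<close>, the right-hand slope is minus the number of elements above
  \<open>t\<close>.\<close>

definition hinge_sum :: "real multiset \<Rightarrow> real \<Rightarrow> real" where
  "hinge_sum X t = (\<Sum>x\<in>#X. max 0 (x - t))"

lemma hinge_sum_simps [simp]:
  "hinge_sum {#} t = 0"
  "hinge_sum (add_mset x X) t = max 0 (x - t) + hinge_sum X t"
  "hinge_sum (X + Y) t = hinge_sum X t + hinge_sum Y t"
  by (simp_all add: hinge_sum_def)

lemma hinge_sum_nonneg: "hinge_sum X t \<ge> 0"
  by (induction X) auto

lemma convex_on_hinge: "convex_on UNIV (\<lambda>x::real. max 0 (x - t))"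
proof (rule convex_onI)
  fix u x y :: real assume "0 < u" "u < 1"
  hence "(1 - u) * (x - t) \<le> (1 - u) * max 0 (x - t)" "u * (y - t) \<le> u * max 0 (y - t)"
    by (auto intro!: mult_left_mono)
  moreover have "(1 - u) *\<^sub>R x + u *\<^sub>R y - t = (1 - u) * (x - t) + u * (y - t)"
    by (simp add: algebra_simps)
  moreover have "0 \<le> (1 - u) * max 0 (x - t)" "0 \<le> u * max 0 (y - t)"
    using \<open>0 < u\<close> \<open>u < 1\<close> by auto
  ultimately show "max 0 ((1 - u) *\<^sub>R x + u *\<^sub>R y - t) \<le> (1 - u) * max 0 (x - t) + u * max 0 (y - t)"
    by linarith
qed auto

lemma majorized_size: "majorized X Y \<Longrightarrow> size X = size Y"
  by (simp add: majorized_def)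

lemma majorizedD: "majorized X Y \<Longrightarrow> convex_on UNIV f \<Longrightarrow> (\<Sum>x\<in>#X. f x) \<le> (\<Sum>y\<in>#Y. f y)"
  by (simp add: majorized_def)

lemma majorized_refl [simp]: "majorized X X"
  by (simp add: majorized_def)

lemma majorized_trans: "majorized X Y \<Longrightarrow> majorized Y Z \<Longrightarrow> majorized X Z"
  unfolding majorized_def by force

lemma majorized_hinge_sum: "majorized X Y \<Longrightarrow> hinge_sum X t \<le> hinge_sum Y t"
  unfolding hinge_sum_def by (rule majorizedD[OF _ convex_on_hinge])

lemma convex_on_UNIV_linear: "convex_on UNIV (\<lambda>x::real. c * x)"
  by (rule convex_onI) (auto simp: algebra_simps)

lemma sum_mset_uminus: "(\<Sum>x\<in>#X. - x) = - \<Sum>\<^sub># (X :: real multiset)"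
  by (induction X) auto

lemma majorized_sum_mset: "majorized X Y \<Longrightarrow> \<Sum>\<^sub># X = \<Sum>\<^sub># Y"
  using majorizedD[OF _ convex_on_UNIV_linear, of X Y 1] majorizedD[OF _ convex_on_UNIV_linear, of X Y "-1"]
  by (simp add: sum_mset_uminus)

text \<open>Convex functions on the whole line are continuous, so both sums converge by continuity
  of the roots and the inequality survives. Majorization is asked only eventually, since perturbed
  configurations become generic only for large \<open>N\<close>.\<close>

lemma majorized_limit:
  assumes X: "coeffs_tendsto (\<lambda>N. root_poly (X N)) (root_poly X')" "\<And>N. size (X N) = size X'"
    and Y: "coeffs_tendsto (\<lambda>N. root_poly (Y N)) (root_poly Y')" "\<And>N. size (Y N) = size Y'"
    and maj: "\<forall>\<^sub>F N in sequentially. majorized (X N) (Y N)"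
  shows   "majorized X' Y'"
  unfolding majorized_def
proof (intro conjI allI impI)
  from eventually_happens[OF maj] obtain N where "majorized (X N) (Y N)"
    by auto
  thus "size X' = size Y'"
    using X(2) Y(2) majorized_size by metis
next
  fix f :: "real \<Rightarrow> real" assume f: "convex_on UNIV f"
  hence cont: "continuous_on UNIV f"
    by (intro convex_on_continuous) auto
  show "(\<Sum>x\<in>#X'. f x) \<le> (\<Sum>y\<in>#Y'. f y)"
    by (rule tendsto_le[OF _ tendsto_sum_roots[OF cont Y] tendsto_sum_roots[OF cont X]])
       (use maj f in \<open>auto elim!: eventually_mono simp: majorizedD\<close>)
qed

text \<open>
  The second difference of \<open>max 0 (x - t)\<close> in \<open>t\<close> is a hat function, which for a small step
  detects the multiplicity of a single point.
\<close>

lemma hinge_sum_determines: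
  assumes "\<And>t. hinge_sum X t = hinge_sum Y t"
  shows   "X = Y"
proof (rule multiset_eqI)
  fix a :: real
  define D where "D = set_mset (X + Y) - {a}"
  obtain h where h: "h > 0" "\<And>d. d \<in> D \<Longrightarrow> h \<le> \<bar>d - a\<bar>"
  proof -
    have "closed D"
      by (intro finite_imp_closed) (simp add: D_def)
    hence "open (- D)" "a \<in> - D"
      using open_Compl by (auto simp only: D_def)
    then obtain h where "h > 0" "ball a h \<subseteq> - D"
      by (meson open_contains_ball)
    thus thesis
      by (intro that[of h]) (auto simp: subset_iff dist_real_def abs_minus_commute not_less[symmetric])
  qed
  have *: "hinge_sum Z (a - h) + hinge_sum Z (a + h) - 2 * hinge_sum Z a = h * count Z a"
    if "set_mset Z - {a} \<subseteq> D" for Z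
    using that
  proof (induction Z)
    case (add z Z)
    have "max 0 (z - (a - h)) + max 0 (z - (a + h)) - 2 * max 0 (z - a) = (if z = a then h else 0)"
    proof (cases "z = a")
      case False
      hence "h \<le> \<bar>z - a\<bar>"
        using add.prems by (intro h(2)) auto
      thus ?thesis
        using h(1) False by (auto simp: max_def)
    qed (use h(1) in auto)
    thus ?case
      using add by (auto simp: algebra_simps)
  qed simp
  have "h * count X a = h * count Y a"
    using *[of X, unfolded assms] *[of Y] by (metis D_def Diff_mono Un_upper1 Un_upper2 order_refl set_mset_union)
  thus "count X a = count Y a"
    using h(1) by simp
qed

lemma majorized_antisym: "majorized X Y \<Longrightarrow> majorized Y X \<Longrightarrow> X = Y"
  by (intro hinge_sum_determines antisym majorized_hinge_sum)

lemma hinge_sum_eq_0: "(\<And>x. x \<in># X \<Longrightarrow> x \<le> t) \<Longrightarrow> hinge_sum X t = 0"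
  by (induction X) auto

lemma hinge_sum_le_card:
  fixes t m :: real
  assumes "\<And>x. x \<in># X \<Longrightarrow> x \<le> m" "t \<le> m"
  shows   "hinge_sum X t \<le> size (filter_mset (\<lambda>x. x > t) X) * (m - t)"
  using assms
proof (induction X)
  case (add x X)
  hence "x \<le> m" "hinge_sum X t \<le> size (filter_mset (\<lambda>x. x > t) X) * (m - t)"
    by auto
  thus ?case
    by (simp add: algebra_simps)
qed simp

text \<open>Going from \<open>t\<close> down to \<open>v\<close>, each element above
  \<open>t\<close> gains exactly \<open>t - v\<close> and no other element loses.\<close>

lemma hinge_sum_decrease:
  fixes t v :: real
  assumes "v \<le> t"
  shows   "hinge_sum X t + size (filter_mset (\<lambda>x. x > t) X) * (t - v) \<le> hinge_sum X v"
  using assms by (induction X) (auto simp: algebra_simps)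

lemma hinge_sum_eq_upper:
  fixes t :: real
  assumes "\<And>x. x \<in># X \<Longrightarrow> t \<le> x"
  shows   "hinge_sum X t = \<Sum>\<^sub># X - size X * t"
  using assms by (induction X) (auto simp: algebra_simps)

lemma size_mult_le_sum_mset:
  fixes t :: real
  assumes "\<And>x. x \<in># X \<Longrightarrow> t \<le> x"
  shows   "size X * t \<le> \<Sum>\<^sub># X"
  using assms
proof (induction X)
  case (add x X)
  hence "t \<le> x" "size X * t \<le> \<Sum>\<^sub># X"
    by auto
  thus ?case
    by (simp add: algebra_simps)
qed simp

text \<open>
  The Hardy--Littlewood--Polya reduction: the largest \<open>x \<in> X\<close> is produced from the two elements
  \<open>v < x \<le> u\<close> of \<open>Y\<close> next to it by moving them towards each other to \<open>u + v - x\<close> and \<open>x\<close>.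
\<close>

lemma hinge_sum_transfer_step:
  assumes x: "\<And>x'. x' \<in># X \<Longrightarrow> x' \<le> x"
    and hi: "\<And>y. y \<in># U \<Longrightarrow> x \<le> y" "x \<le> u" and lo: "\<And>y. y \<in># V \<Longrightarrow> y \<le> v" "v < x"
    and le: "\<And>t. hinge_sum (add_mset x X) t \<le> hinge_sum (add_mset u (add_mset v (U + V))) t"
  shows   "hinge_sum X t \<le> hinge_sum (add_mset (u + v - x) (U + V)) t"
proof -
  let ?w = "u + v - x"
  consider "t \<ge> x" | "t \<le> v" | "v < t" "t < x"
    by linarith
  thus ?thesis
  proof cases
    case 1
    hence "hinge_sum X t = 0"
      using x by (intro hinge_sum_eq_0) force
    thus ?thesis
      using hinge_sum_nonneg by simp
  next
    \<comment> \<open>The points \<open>x\<close>, \<open>u\<close>, \<open>v\<close> and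
      \<open>u + v - x\<close> are all at least \<open>t\<close>, where hinges are affine, so the
      hypothesis at \<open>t\<close> becomes the claim after cancelling
      \<open>x - t\<close>.\<close>
    case 2
    thus ?thesis
      using le[of t] hi lo by (simp add: max_def split: if_splits)
  next
    case 3
    define k where "k = size (filter_mset (\<lambda>x. x > t) X)"
    have U: "hinge_sum U s = \<Sum>\<^sub># U - size U * s" if "s \<le> x" for s :: real
      using order_trans[OF that hi(1)] by (intro hinge_sum_eq_upper)
    \<comment> \<open>If \<open>k\<close> is at most the size of \<open>U\<close>, each of the
      \<open>k\<close> elements contributes at most \<open>x - t\<close>, and each element of
      \<open>U\<close> at least that. Otherwise the hypothesis is used at \<open>v\<close>, where
      \<open>V\<close> contributes nothing; from \<open>v\<close> to \<open>t\<close> the left side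
      drops by at least \<open>(size U + 1) * (t - v)\<close> and the affine bound on the right by
      exactly that.\<close>
    show ?thesis
    proof (cases "k \<le> size U")
      case True
      have "hinge_sum X t \<le> k * (x - t)"
        unfolding k_def using x 3 by (intro hinge_sum_le_card) auto
      also have "\<dots> \<le> size U * (x - t)"
        using True 3 by (intro mult_right_mono) auto
      also have "size U * x \<le> \<Sum>\<^sub># U"
        using hi by (intro size_mult_le_sum_mset) auto
      hence "size U * (x - t) \<le> hinge_sum U t"
        using 3 U[of t, OF less_imp_le] by (simp only: right_diff_distrib)
      finally show ?thesis
        using hinge_sum_nonneg[of V t] by simp
    next
      case False
      have V: "hinge_sum V v = 0"
        using lo by (intro hinge_sum_eq_0) auto
      have Uv: "hinge_sum U v = \<Sum>\<^sub># U - size U * v" "hinge_sum U t = \<Sum>\<^sub># U - size U * t"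
        using 3 by (intro U; simp)+
      have "hinge_sum X t + real (Suc (size U)) * (t - v) \<le> hinge_sum X t + k * (t - v)"
        using False 3 by (intro add_left_mono mult_right_mono) auto
      also have "\<dots> \<le> hinge_sum X v"
        unfolding k_def using 3 by (intro hinge_sum_decrease) auto
      also have "\<dots> \<le> hinge_sum U v + (?w - v)"
        using le[of v] V hi lo by simp
      also have "\<dots> = hinge_sum U t + (?w - t) + real (Suc (size U)) * (t - v)"
        unfolding Uv by (simp add: algebra_simps)
      finally show ?thesis
        using hinge_sum_nonneg[of V t] by simp
    qed
  qed
qed

text \<open>An abstract preorder \<open>le\<close> is used so that the result applies directly to
  majorization of images under an operator. Each round disposes of the largest element
  \<open>x\<close> of \<open>X\<close>: a transfer makes \<open>x\<close> occur on both sides, and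
  it then joins the common part.\<close>

lemma majorized_transfer_induct:
  fixes le :: "real multiset \<Rightarrow> real multiset \<Rightarrow> bool"
  assumes refl: "\<And>X. le X X" and trans: "\<And>X Y Z. le X Y \<Longrightarrow> le Y Z \<Longrightarrow> le X Z"
    and transfer: "\<And>m d e Z. 0 \<le> d \<Longrightarrow> d \<le> e \<Longrightarrow>
      le (add_mset (m + d) (add_mset (m - d) Z)) (add_mset (m + e) (add_mset (m - e) Z))"
    and maj: "majorized X Y"
  shows "le X Y"
proof -
  \<comment> \<open>Of \<open>x\<close> and its mirror image \<open>u + v - x\<close>, the larger
    takes the role of \<open>m + d\<close>.\<close>
  have transfer': "le (add_mset x (add_mset (u + v - x) Z)) (add_mset u (add_mset v Z))"
    if "v \<le> x" "x \<le> u" for u v x Z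
  proof -
    define m where "m = (u + v) / 2"
    define e where "e = (u - v) / 2"
    have uv: "u = m + e" "v = m - e"
      by (auto simp: m_def e_def field_simps)
    show ?thesis
    proof (cases "x \<ge> m")
      case True
      show ?thesis
        using transfer[of "x - m" e m Z] True that by (simp add: uv algebra_simps)
    next
      case False
      show ?thesis
        using transfer[of "m - x" e m Z] False that by (simp add: uv algebra_simps add_mset_commute)
    qed
  qed
  \<comment> \<open>The common part \<open>Z\<close> is carried through the induction because
    compatibility of \<open>le\<close> with adding elements is not among the assumptions.\<close>
  have "le (X + Z) (Y + Z)"
    if "size X = size Y" "\<Sum>\<^sub># X = \<Sum>\<^sub># Y" "\<And>t. hinge_sum X t \<le> hinge_sum Y t" for X Y Z
    using that
  proof (induction "size X" arbitrary: X Y Z)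
    case 0
    thus ?case by (auto simp: refl)
  next
    case (Suc n)
    define x where "x = Max (set_mset X)"
    have "X \<noteq> {#}" "Y \<noteq> {#}"
      using Suc.hyps(2) Suc.prems(1) by auto
    hence xX: "x \<in># X" and x_max: "\<And>x'. x' \<in># X \<Longrightarrow> x' \<le> x"
      unfolding x_def by (auto intro!: Max_in)
    define X' where "X' = X - {#x#}"
    have X: "X = add_mset x X'"
      using xX by (simp add: X'_def)
    \<comment> \<open>If all of \<open>Y\<close> were below \<open>x\<close>, its hinge sum at its
      own maximum would be 0, while that of \<open>X\<close> is positive there.\<close>
    have "\<exists>y. y \<in># Y \<and> x \<le> y"
    proof (rule ccontr)
      assume *: "\<not> ?thesis"
      define t where "t = Max (set_mset Y)"
      have "t \<in># Y" "\<And>y. y \<in># Y \<Longrightarrow> y \<le> t"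
        unfolding t_def using \<open>Y \<noteq> {#}\<close> by (auto intro!: Max_in)
      hence "t < x" "hinge_sum Y t = 0"
        using * by (auto intro!: hinge_sum_eq_0)
      thus False
        using Suc.prems(3)[of t] hinge_sum_nonneg[of X' t] by (simp add: X)
    qed
    then obtain u where u: "u \<in># Y" "x \<le> u"
      by blast
    define Y1 where "Y1 = Y - {#u#}"
    have Y: "Y = add_mset u Y1"
      using u by (simp add: Y1_def)
    show ?case
    proof (cases "u = x")
      case True
      have "le (X' + add_mset x Z) (Y1 + add_mset x Z)"
        by (rule Suc.hyps(1)) (use Suc.prems Suc.hyps(2) in \<open>auto simp: X Y True\<close>)
      thus ?thesis
        by (simp add: X Y True)
    next
      case False
      define L where "L = filter_mset (\<lambda>y. y < x) Y1"
      \<comment> \<open>Otherwise every element of \<open>Y\<close> is at least \<open>x\<close> and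
        \<open>u\<close> exceeds it, so \<open>Y\<close> would have a larger sum than
        \<open>X\<close>, whose elements are at most \<open>x\<close>.\<close>
      have "L \<noteq> {#}"
      proof
        assume "L = {#}"
        hence "\<forall>y\<in>#Y1. x \<le> y"
          unfolding L_def by (auto simp: filter_mset_eq_mempty_iff not_less)
        hence "size Y1 * x \<le> \<Sum>\<^sub># Y1"
          by (intro size_mult_le_sum_mset) auto
        moreover have "\<Sum>\<^sub># X' \<le> size X' * x"
          using size_mult_le_sum_mset[of "image_mset uminus X'" "-x"] x_max X
          by (force simp: sum_mset_uminus)
        ultimately show False
          using Suc.prems(1,2) u(2) False by (simp add: X Y)
      qed
      define v where "v = Max (set_mset L)"
      have v: "v \<in># L" "\<And>y. y \<in># L \<Longrightarrow> y \<le> v"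
        unfolding v_def using \<open>L \<noteq> {#}\<close> by (auto intro!: Max_in)
      define U where "U = filter_mset (\<lambda>y. \<not> y < x) Y1"
      define V where "V = L - {#v#}"
      have L: "L = add_mset v V"
        using v(1) by (simp add: V_def)
      have Y1: "Y1 = add_mset v (U + V)"
        using multiset_partition[of Y1 "\<lambda>y. y < x"] by (simp add: L_def[symmetric] U_def[symmetric] L add.commute[of V])
      have "v < x"
        using v(1) by (simp add: L_def)
      define Y' where "Y' = add_mset (u + v - x) (U + V)"
      have "hinge_sum X' t \<le> hinge_sum Y' t" for t
        unfolding Y'_def
      proof (rule hinge_sum_transfer_step)
        show "x' \<le> x" if "x' \<in># X'" for x'
          using x_max that by (simp add: X)
        show "x \<le> y" if "y \<in># U" for y
          using that by (simp add: U_def)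
        show "y \<le> v" if "y \<in># V" for y
          using v(2) that by (simp add: L)
        show "hinge_sum (add_mset x X') t \<le> hinge_sum (add_mset u (add_mset v (U + V))) t" for t
          using Suc.prems(3)[of t] unfolding X Y Y1 .
      qed (fact u(2) \<open>v < x\<close>)+
      moreover have "n = size X'" "size X' = size Y'" "\<Sum>\<^sub># X' = \<Sum>\<^sub># Y'"
        using Suc.prems(1,2) Suc.hyps(2) unfolding X Y Y1 Y'_def by simp_all
      ultimately have "le (X' + add_mset x Z) (Y' + add_mset x Z)"
        by (intro Suc.hyps(1))
      hence "le (X + Z) (add_mset x (add_mset (u + v - x) (U + V + Z)))"
        by (simp add: X Y'_def)
      moreover have "le (add_mset x (add_mset (u + v - x) (U + V + Z))) (add_mset u (add_mset v (U + V + Z)))"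
        using \<open>v < x\<close> u(2) by (intro transfer') auto
      ultimately have "le (X + Z) (add_mset u (add_mset v (U + V + Z)))"
        by (rule trans)
      thus ?thesis
        by (simp add: Y Y1)
    qed
  qed
  from this[of X Y "{#}"] show ?thesis
    using maj by (simp add: majorized_size majorized_sum_mset majorized_hinge_sum)
qed

section \<open>Counting interlaced roots\<close>

lemma sign_root_poly:
  assumes "t \<notin># X"
  shows   "0 < (-1) ^ size (filter_mset (\<lambda>x. x > t) X) * poly (root_poly X) t"
  using assms
proof (induction X)
  case (add x X)
  let ?q = "(-1) ^ size (filter_mset (\<lambda>x. x > t) X) * poly (root_poly X) t"
  have "0 < ?q" "x \<noteq> t"
    using add by auto
  hence "0 < \<bar>t - x\<bar> * ?q"
    by simp
  thus ?case
    using \<open>x \<noteq> t\<close> by (auto simp: poly_root_poly abs_if algebra_simps split: if_splits)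
qed simp

lemma poly_root_poly_less_0_iff:
  assumes "t \<notin># X"
  shows   "poly (root_poly X) t < 0 \<longleftrightarrow> odd (size (filter_mset (\<lambda>x. x > t) X))"
  using sign_root_poly[OF assms]
  by (cases "even (size (filter_mset (\<lambda>x. x > t) X))") (auto)

lemma poly_pderiv_root_poly_same:
  "poly (pderiv (root_poly (add_mset t X))) t = poly (root_poly X) t"
  by (simp add: pderiv_mult pderiv_pCons del: mult_pCons_left)

lemma card_greater_Min:
  assumes "finite A" "{a \<in> A. a > t} \<noteq> {}"
  defines "u \<equiv> Min {a \<in> A. a > (t :: real)}"
  shows   "u \<in> A" "u > t" "card {a \<in> A. a > t} = Suc (card {a \<in> A. a > u})"
proof -
  have "u \<in> {a \<in> A. a > t}"
    unfolding u_def using assms by (intro Min_in) auto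
  thus u: "u \<in> A" "u > t"
    by auto
  have "u \<le> a" if "a \<in> A" "a > t" for a
    unfolding u_def using assms that by (intro Min_le) auto
  hence "{a \<in> A. a > t} = insert u {a \<in> A. a > u}"
    using u by fastforce
  thus "card {a \<in> A. a > t} = Suc (card {a \<in> A. a > u})"
    using \<open>finite A\<close> by simp
qed

text \<open>A discrete intermediate value argument. At the largest element of \<open>A\<close>,
  parity forces \<open>f\<close> to be at least 1. One element further down, monotonicity gives at
  least the new count, and parity excludes equality. So \<open>f\<close> exceeds the count strictly
  on \<open>A\<close>; elsewhere the next element of \<open>A\<close> to the right gives the weak
  inequality.\<close>

lemma card_greater_le_antimono_parity:
  fixes f :: "real \<Rightarrow> nat"
  assumes A: "finite A" and anti: "\<And>x y. x \<le> y \<Longrightarrow> f y \<le> f x"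
    and odd: "\<And>a. a \<in> A \<Longrightarrow> odd (f a + card {b \<in> A. b > a})"
  shows   "card {a \<in> A. a > t} \<le> f t"
proof -
  have *: "card {b \<in> A. b > a} < f a" if "a \<in> A" for a
    using that
  proof (induction "card {b \<in> A. b > a}" arbitrary: a rule: less_induct)
    case less
    show ?case
    proof (cases "{b \<in> A. b > a} = {}")
      case True
      thus ?thesis
        using odd[OF less.prems] unfolding True by (simp add: odd_pos)
    next
      case False
      define u where "u = Min {b \<in> A. b > a}"
      note u = card_greater_Min[OF A False, folded u_def]
      have "card {b \<in> A. b > u} < f u"
        using u by (intro less.hyps) auto
      hence "card {b \<in> A. b > a} \<le> f a"
        using u anti[of a u] by auto
      moreover have "card {b \<in> A. b > a} \<noteq> f a"
        using odd[OF less.prems] by auto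
      ultimately show ?thesis
        by simp
    qed
  qed
  show ?thesis
  proof (cases "{b \<in> A. b > t} = {}")
    case True
    thus ?thesis by (simp only: card.empty)
  next
    case False
    define u where "u = Min {b \<in> A. b > t}"
    note u = card_greater_Min[OF A False, folded u_def]
    show ?thesis
      using *[of u] u anti[of t u] by auto
  qed
qed

lemma size_filter_greater_less:
  assumes "t \<notin># X"
  shows   "size (filter_mset (\<lambda>x. x > t) X) + size (filter_mset (\<lambda>x. x < (t::real)) X) = size X"
  using assms by (induction X) auto

lemma size_filter_mono:
  "(\<And>x. P x \<Longrightarrow> Q x) \<Longrightarrow> size (filter_mset P X) \<le> size (filter_mset Q X)"
  by (induction X) (auto intro: le_SucI)

lemma mult_neg_iff_parity:
  fixes p q :: real
  assumes "p \<noteq> 0" "q \<noteq> 0" "p < 0 \<longleftrightarrow> odd m" "q < 0 \<longleftrightarrow> odd n"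
  shows   "p * q < 0 \<longleftrightarrow> odd (m + n)"
proof -
  have "p * q < 0 \<longleftrightarrow> (p < 0 \<longleftrightarrow> \<not> q < 0)"
    using assms(1,2) by (auto simp: mult_less_0_iff)
  also have "\<dots> \<longleftrightarrow> odd (m + n)"
    unfolding assms(3,4) by auto
  finally show ?thesis .
qed

text \<open>With \<open>f\<close> and \<open>g\<close> counting the elements of \<open>X\<close> and
  \<open>A\<close> above a point, the signs make \<open>f + g\<close> odd on \<open>A\<close>, which
  yields \<open>g \<le> f\<close>. The same for elements below gives \<open>f \<le> g + 1\<close>,
  as \<open>X\<close> has one element more than \<open>A\<close>. The sign of the product at
  \<open>t\<close> is the parity of \<open>f + g\<close> and decides between the two values.\<close>

lemma interlacing_count:
  fixes A :: "real set" and X :: "real multiset"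
  assumes A: "finite A" and sz: "size X = Suc (card A)"
    and sign: "\<And>a. a \<in> A \<Longrightarrow>
      poly (root_poly X) a * poly (pderiv (root_poly (mset_set A))) a < 0"
    and t: "t \<notin> A" "t \<notin># X"
  shows   "size (filter_mset (\<lambda>x. x > t) X) = card {a \<in> A. a > t} +
             (if poly (root_poly X) t * poly (root_poly (mset_set A)) t < 0 then 1 else 0)"
proof -
  define f where "f = (\<lambda>t. size (filter_mset (\<lambda>x. x > t) X))"
  define f' where "f' = (\<lambda>t. size (filter_mset (\<lambda>x. x < - t) X))"
  define g where "g = (\<lambda>t. card {a \<in> A. a > t})"
  define g' where "g' = (\<lambda>t. card {a \<in> A. a < t})"
  have size_g: "size (filter_mset (\<lambda>x. x > t) (mset_set B)) = card {b \<in> B. b > t}"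
    if "finite B" for t :: real and B
    using that by (simp add: filter_mset_mset_set)
  have fin: "finite {a \<in> A. Q a}" for Q
    using A by simp
  have gg': "g t + g' t = card (A - {t})" for t
  proof -
    have "g t + g' t = card ({a \<in> A. a > t} \<union> {a \<in> A. a < t})"
      unfolding g_def g'_def using A by (subst card_Un_disjoint) auto
    also have "{a \<in> A. a > t} \<union> {a \<in> A. a < t} = A - {t}"
      by auto
    finally show ?thesis .
  qed
  have g'_uminus: "card {b \<in> uminus ` A. b > - t} = g' t" for t
  proof -
    have "{b \<in> uminus ` A. b > - t} = uminus ` {a \<in> A. a < t}"
      by auto
    thus ?thesis
      by (simp add: g'_def card_image)
  qed
  have notin: "a \<notin># X" if "a \<in> A" for a
    using sign[OF that] by (auto simp: poly_root_poly_eq_0_iff[symmetric])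
  have odd: "odd (f a + g a)" if "a \<in> A" for a
  proof -
    \<comment> \<open>At its simple root \<open>a\<close>, the derivative is the product of the
      remaining factors, whose sign is governed by \<open>g a\<close>.\<close>
    have "mset_set A = add_mset a (mset_set (A - {a}))"
      using A that by (simp add: mset_set.remove)
    hence "poly (root_poly X) a * poly (root_poly (mset_set (A - {a}))) a < 0"
      using sign[OF that] by (simp add: poly_pderiv_root_poly_same del: root_poly_add_mset)
    moreover have "{b \<in> A - {a}. b > a} = {b \<in> A. b > a}"
      by auto
    hence "poly (root_poly (mset_set (A - {a}))) a < 0 \<longleftrightarrow> odd (g a)"
      using poly_root_poly_less_0_iff[of a "mset_set (A - {a})"] A size_g[of "A - {a}" a]
      by (simp add: g_def)
    moreover have "poly (root_poly X) a < 0 \<longleftrightarrow> odd (f a)"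
      unfolding f_def by (rule poly_root_poly_less_0_iff[OF notin[OF that]])
    ultimately show ?thesis
      by (subst mult_neg_iff_parity[symmetric]) auto
  qed
  have "g t \<le> f t"
    unfolding g_def
  proof (rule card_greater_le_antimono_parity[where f = f, OF A])
    show "f y \<le> f x" if "x \<le> y" for x y
      unfolding f_def using that by (intro size_filter_mono) auto
  qed (use odd in \<open>simp add: g_def\<close>)
  \<comment> \<open>Reflection turns counts below into counts above. At a point of \<open>A\<close>
    the two counts of \<open>X\<close> add up to \<open>card A + 1\<close> and those of
    \<open>A\<close> to \<open>card A - 1\<close>, an even total, so odd parity carries over to the
    other side.\<close>
  moreover have "g' t \<le> f' (- t)"
    unfolding g'_uminus[symmetric]
  proof (rule card_greater_le_antimono_parity[where f = f'])
    show "f' y \<le> f' x" if "x \<le> y" for x y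
      unfolding f'_def using that by (intro size_filter_mono) auto
  next
    fix b assume "b \<in> uminus ` A"
    then obtain a where a: "a \<in> A" "b = - a"
      by blast
    have "f a + f' b = size X"
      unfolding f_def f'_def a(2) minus_minus by (rule size_filter_greater_less[OF notin[OF a(1)]])
    moreover have "g a + g' a = card A - 1"
      using gg'[of a] a(1) by (simp only: card_Diff_singleton)
    moreover have "card A > 0"
      using A a(1) by (metis card_gt_0_iff empty_iff)
    ultimately have "(f a + g a) + (f' b + g' a) = 2 * card A"
      using sz by linarith
    hence "odd (f' b + g' a)"
      using odd[OF a(1)] by (metis dvd_triv_left even_add)
    thus "odd (f' b + card {c \<in> uminus ` A. c > b})"
      unfolding a(2) g'_uminus .
  qed (use A in simp)
  moreover have "f t + f' (- t) = size X"
    unfolding f_def f'_def minus_minus by (rule size_filter_greater_less[OF t(2)])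
  moreover have "g t + g' t = card A"
    using gg'[of t] t(1) by simp
  ultimately have "f t = g t \<or> f t = Suc (g t)"
    using sz by linarith
  moreover have "poly (root_poly X) t * poly (root_poly (mset_set A)) t < 0 \<longleftrightarrow> odd (f t + g t)"
  proof -
    have "poly (root_poly (mset_set A)) t < 0 \<longleftrightarrow> odd (g t)"
      using poly_root_poly_less_0_iff[of t "mset_set A"] t(1) A size_g[OF A, of t]
      by (simp add: g_def)
    moreover have "poly (root_poly X) t < 0 \<longleftrightarrow> odd (f t)"
      unfolding f_def by (rule poly_root_poly_less_0_iff[OF t(2)])
    moreover have "poly (root_poly X) t \<noteq> 0" "poly (root_poly (mset_set A)) t \<noteq> 0"
      using t A by (simp_all add: poly_root_poly_eq_0_iff)
    ultimately show ?thesis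
      by (intro mult_neg_iff_parity)
  qed
  ultimately have "f t = g t + (if poly (root_poly X) t * poly (root_poly (mset_set A)) t < 0 then 1 else 0)"
    by auto
  thus ?thesis
    by (simp only: f_def g_def)
qed

lemma exists_between_notin_finite:
  assumes "finite F" "a < (b::real)"
  obtains t where "a < t" "t < b" "t \<notin> F"
proof -
  have "infinite ({a<..<b} - F)"
    using assms by (simp add: infinite_Ioo)
  hence "{a<..<b} - F \<noteq> {}"
    by (rule infinite_imp_nonempty)
  then obtain t where "t \<in> {a<..<b} - F"
    by blast
  thus thesis
    using that by auto
qed

text \<open>
  With the exceptional set \<open>F\<close>, the counts need to be compared only at points that are not roots.
\<close>

lemma sum_mset_mono_counts:
  fixes g :: "real \<Rightarrow> real"
  assumes F: "finite F"
    and count: "\<And>t. t > 0 \<Longrightarrow> t \<notin> F \<Longrightarrow>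
      size (filter_mset (\<lambda>x. x > t) X) \<le> size (filter_mset (\<lambda>y. y > t) Y)"
    and g: "\<And>x y. 0 < x \<Longrightarrow> x \<le> y \<Longrightarrow> g x \<le> g y" "\<And>x. 0 < x \<Longrightarrow> 0 \<le> g x"
    and pos: "\<And>x. x \<in># X \<Longrightarrow> 0 < x" "\<And>y. y \<in># Y \<Longrightarrow> 0 < y"
  shows   "(\<Sum>x\<in>#X. g x) \<le> (\<Sum>y\<in>#Y. g y)"
  using count pos
proof (induction "size X" arbitrary: X Y)
  case 0
  have "0 \<le> (\<Sum>y\<in>#Y. g y)"
    using 0(4) g(2) by (induction Y) auto
  thus ?case
    using 0 by simp
next
  case (Suc n)
  define x where "x = Max (set_mset X)"
  have "X \<noteq> {#}"
    using Suc.hyps(2) by auto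
  hence x: "x \<in># X" "\<And>x'. x' \<in># X \<Longrightarrow> x' \<le> x"
    unfolding x_def by (auto intro!: Max_in)
  have "Y \<noteq> {#}"
  proof
    assume "Y = {#}"
    moreover have "0 < x"
      using Suc.prems(2) x(1) by auto
    then obtain t where t: "0 < t" "t < x" "t \<notin> F"
      by (rule exists_between_notin_finite[OF F])
    ultimately have "x \<notin># filter_mset (\<lambda>x. x > t) X"
      using Suc.prems(1)[of t] by auto
    thus False
      using x(1) t by simp
  qed
  define y where "y = Max (set_mset Y)"
  have y: "y \<in># Y" "\<And>y'. y' \<in># Y \<Longrightarrow> y' \<le> y"
    unfolding y_def using \<open>Y \<noteq> {#}\<close> by (auto intro!: Max_in)
  have xy: "x \<le> y"
  proof (rule ccontr)
    assume "\<not> x \<le> y"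
    hence "y < x"
      by simp
    then obtain t where t: "y < t" "t < x" "t \<notin> F"
      by (rule exists_between_notin_finite[OF F])
    have "0 < y"
      using Suc.prems(3) y(1) by auto
    moreover have "filter_mset (\<lambda>y. y > t) Y = {#}"
      using y(2) t(1) by (fastforce simp: filter_mset_eq_mempty_iff)
    hence "size (filter_mset (\<lambda>y. y > t) Y) = 0"
      by (simp only: size_empty)
    ultimately have "size (filter_mset (\<lambda>x. x > t) X) = 0"
      using Suc.prems(1)[OF _ t(3)] t(1) by linarith
    hence "filter_mset (\<lambda>x. x > t) X = {#}"
      by (simp only: size_eq_0_iff_empty)
    thus False
      using x(1) t by (simp add: filter_mset_eq_mempty_iff)
  qed
  define X' where "X' = X - {#x#}"
  define Y' where "Y' = Y - {#y#}"
  have X: "X = add_mset x X'" and Y: "Y = add_mset y Y'"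
    using x(1) y(1) by (simp_all add: X'_def Y'_def)
  have "(\<Sum>x\<in>#X'. g x) \<le> (\<Sum>y\<in>#Y'. g y)"
  proof (rule Suc.hyps(1))
    fix t :: real assume t: "t > 0" "t \<notin> F"
    show "size (filter_mset (\<lambda>x. x > t) X') \<le> size (filter_mset (\<lambda>y. y > t) Y')"
    proof (cases "t < x")
      case True
      thus ?thesis
        using Suc.prems(1)[OF t] xy by (simp add: X Y)
    next
      case False
      hence "filter_mset (\<lambda>x. x > t) X' = {#}"
        using x(2) by (fastforce simp: filter_mset_eq_mempty_iff X)
      thus ?thesis
        by (simp only: size_empty le0)
    qed
  qed (use Suc.hyps(2) Suc.prems(2,3) in \<open>auto simp: X Y\<close>)
  moreover have "g x \<le> g y"
    using Suc.prems(2) x(1) xy by (intro g) auto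
  ultimately show ?case
    by (simp add: X Y)
qed

section \<open>Convex functions and spreading away from a point\<close>

lemma convex_supporting_line:
  fixes f :: "real \<Rightarrow> real"
  assumes "convex_on UNIV f"
  obtains s where "\<And>y. f m + s * (y - m) \<le> f y"
  using convex_le_Inf_differential[OF assms, of m] that by auto

lemma convex_on_diff_linear:
  fixes f :: "real \<Rightarrow> real"
  assumes "convex_on UNIV f"
  shows   "convex_on UNIV (\<lambda>x. f x - (c + s * (x - m)))"
proof (rule convex_onI)
  fix u x y :: real assume "0 < u" "u < 1"
  hence "f ((1 - u) *\<^sub>R x + u *\<^sub>R y) \<le> (1 - u) * f x + u * f y"
    using assms by (intro convex_onD) auto
  moreover have "c + s * ((1 - u) *\<^sub>R x + u *\<^sub>R y - m) =
      (1 - u) * (c + s * (x - m)) + u * (c + s * (y - m))"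
    by (simp add: algebra_simps)
  ultimately show "f ((1 - u) *\<^sub>R x + u *\<^sub>R y) - (c + s * ((1 - u) *\<^sub>R x + u *\<^sub>R y - m))
      \<le> (1 - u) * (f x - (c + s * (x - m))) + u * (f y - (c + s * (y - m)))"
    by (simp add: algebra_simps)
qed auto

lemma convex_mono_above_min:
  fixes f :: "real \<Rightarrow> real"
  assumes f: "convex_on UNIV f" and min: "\<And>y. f m \<le> f y" and xy: "m < x" "x \<le> y"
  shows   "f x \<le> f y"
proof -
  define u where "u = (x - m) / (y - m)"
  have u: "0 \<le> u" "u \<le> 1"
    using xy by (auto simp: u_def field_simps)
  have "u * (y - m) = x - m"
    using xy by (simp add: u_def)
  hence "x = (1 - u) *\<^sub>R m + u *\<^sub>R y"
    by (simp add: algebra_simps)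
  hence "f x \<le> (1 - u) * f m + u * f y"
    using convex_onD[OF f u, of m y] by simp
  also have "\<dots> \<le> (1 - u) * f y + u * f y"
    using min u by (intro add_right_mono mult_left_mono) auto
  finally show ?thesis
    by (simp add: algebra_simps)
qed

lemma convex_on_reflect: "convex_on UNIV f \<Longrightarrow> convex_on UNIV (\<lambda>x::real. f (- x))"
proof (rule convex_onI)
  fix u x y :: real assume f: "convex_on UNIV f" and u: "0 < u" "u < 1"
  have "- ((1 - u) *\<^sub>R x + u *\<^sub>R y) = (1 - u) *\<^sub>R (- x) + u *\<^sub>R (- y)"
    by simp
  thus "f (- ((1 - u) *\<^sub>R x + u *\<^sub>R y)) \<le> (1 - u) * f (- x) + u * f (- y)"
    using convex_onD[OF f, of u "- x" "- y"] u by simp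
qed auto

text \<open>Both halves are expressed through the distance from \<open>m\<close>, so one comparison
  lemma about positive numbers serves the two sides.\<close>

lemma sum_mset_split_at:
  fixes f :: "real \<Rightarrow> real"
  shows "(\<Sum>x\<in>#X. f x) = (\<Sum>x\<in>#image_mset (\<lambda>x. x - m) (filter_mset (\<lambda>x. m < x) X). f (m + x)) +
     (\<Sum>x\<in>#image_mset (\<lambda>x. m - x) (filter_mset (\<lambda>x. x < m) X). f (m - x)) + count X m * f m"
  by (induction X) (auto simp: algebra_simps)

lemma sum_mset_affine:
  fixes f :: "real \<Rightarrow> real" and c s m :: real
  shows "(\<Sum>x\<in>#X. f x - (c + s * (x - m))) = (\<Sum>x\<in>#X. f x) - (size X * c + s * (\<Sum>\<^sub># X - size X * m))"
  by (induction X) (auto simp: algebra_simps)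

lemma size_filter_image_above:
  assumes "(t::real) > 0"
  shows "size (filter_mset (\<lambda>x. x > t) (image_mset (\<lambda>x. x - m) (filter_mset (\<lambda>x. m < x) X))) =
           size (filter_mset (\<lambda>x. x > m + t) X)"
  using assms by (induction X) auto

lemma size_filter_image_below:
  assumes "(t::real) > 0"
  shows "size (filter_mset (\<lambda>x. x > t) (image_mset (\<lambda>x. m - x) (filter_mset (\<lambda>x. x < m) X))) =
           size (filter_mset (\<lambda>x. x < m - t) X)"
  using assms by (induction X) auto

text \<open>
  Subtracting a supporting line at \<open>m\<close> makes \<open>f\<close> monotone away from \<open>m\<close>, without changing
  the difference of the two sums.
\<close>

lemma majorized_spread_from:
  fixes X Y :: "real multiset"
  assumes "size X = size Y" "\<Sum>\<^sub># X = \<Sum>\<^sub># Y" and F: "finite F"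
    and above: "\<And>t. m < t \<Longrightarrow> t \<notin> F \<Longrightarrow>
      size (filter_mset (\<lambda>x. x > t) X) \<le> size (filter_mset (\<lambda>y. y > t) Y)"
    and below: "\<And>t. t < m \<Longrightarrow> t \<notin> F \<Longrightarrow>
      size (filter_mset (\<lambda>x. x < t) X) \<le> size (filter_mset (\<lambda>y. y < t) Y)"
  shows   "majorized X Y"
  unfolding majorized_def
proof (intro conjI allI impI)
  fix f :: "real \<Rightarrow> real" assume f: "convex_on UNIV f"
  obtain s where s: "\<And>y. f m + s * (y - m) \<le> f y"
    using convex_supporting_line[OF f] by blast
  define g where "g = (\<lambda>x. f x - (f m + s * (x - m)))"
  have "convex_on UNIV g"
    unfolding g_def by (rule convex_on_diff_linear[OF f])
  have gm: "g m = 0" and g0: "0 \<le> g x" for x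
    using s by (auto simp: g_def)
  have mono1: "g (m + x) \<le> g (m + y)" if "0 < x" "x \<le> y" for x y
    by (rule convex_mono_above_min[OF \<open>convex_on UNIV g\<close>, of m]) (use that gm g0 in auto)
  have mono2: "g (m - x) \<le> g (m - y)" if "0 < x" "x \<le> y" for x y
    using convex_mono_above_min[OF convex_on_reflect[OF \<open>convex_on UNIV g\<close>], of "-m" "x - m" "y - m"]
      that gm g0 by simp
  have "(\<Sum>x\<in>#image_mset (\<lambda>x. x - m) (filter_mset (\<lambda>x. m < x) X). g (m + x)) \<le>
        (\<Sum>x\<in>#image_mset (\<lambda>x. x - m) (filter_mset (\<lambda>x. m < x) Y). g (m + x))"
  proof (rule sum_mset_mono_counts[where F = "(\<lambda>t. t - m) ` F"])
    fix t :: real assume "t > 0" "t \<notin> (\<lambda>t. t - m) ` F"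
    moreover from this(2) have "m + t \<notin> F"
      by force
    ultimately show "size (filter_mset (\<lambda>x. x > t) (image_mset (\<lambda>x. x - m) (filter_mset (\<lambda>x. m < x) X))) \<le>
      size (filter_mset (\<lambda>x. x > t) (image_mset (\<lambda>x. x - m) (filter_mset (\<lambda>x. m < x) Y)))"
      using above[of "m + t"] by (simp only: size_filter_image_above) simp
  qed (use F in \<open>auto intro: mono1 g0\<close>)
  moreover have "(\<Sum>x\<in>#image_mset (\<lambda>x. m - x) (filter_mset (\<lambda>x. x < m) X). g (m - x)) \<le>
        (\<Sum>x\<in>#image_mset (\<lambda>x. m - x) (filter_mset (\<lambda>x. x < m) Y). g (m - x))"
  proof (rule sum_mset_mono_counts[where F = "(\<lambda>t. m - t) ` F"])
    fix t :: real assume "t > 0" "t \<notin> (\<lambda>t. m - t) ` F"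
    moreover from this(2) have "m - t \<notin> F"
      by force
    ultimately show "size (filter_mset (\<lambda>x. x > t) (image_mset (\<lambda>x. m - x) (filter_mset (\<lambda>x. x < m) X))) \<le>
      size (filter_mset (\<lambda>x. x > t) (image_mset (\<lambda>x. m - x) (filter_mset (\<lambda>x. x < m) Y)))"
      using below[of "m - t"] by (simp only: size_filter_image_below) simp
  qed (use F in \<open>auto intro: mono2 g0\<close>)
  ultimately have "(\<Sum>x\<in>#X. g x) \<le> (\<Sum>y\<in>#Y. g y)"
    unfolding sum_mset_split_at[of g X m] sum_mset_split_at[of g Y m] by (simp add: gm)
  thus "(\<Sum>x\<in>#X. f x) \<le> (\<Sum>y\<in>#Y. f y)"
    using assms(1,2) by (simp add: g_def sum_mset_affine)
qed fact

section \<open>First-order operators\<close>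

text \<open>
  The roots \<open>X\<close> and \<open>Y\<close> are both interlaced by \<open>{m} \<union> S\<close>, and lowering the polynomial by a multiple of
  \<open>root_poly S\<close> lowers its quotient by \<open>(t - m) root_poly S\<close> above \<open>m\<close> and raises it below,
  so the roots move away from \<open>m\<close>.
\<close>

lemma majorized_interlaced:
  fixes S :: "real set"
  assumes S: "finite S" "m \<notin> S" and sz: "size X = card S + 2" "size Y = card S + 2"
    and eq: "root_poly Y = root_poly X - smult \<eta> (root_poly (mset_set S))" and \<eta>: "0 \<le> \<eta>"
    and signX: "\<And>a. a \<in> insert m S \<Longrightarrow>
      poly (root_poly X) a * poly (pderiv (root_poly (mset_set (insert m S)))) a < 0"
    and signY: "\<And>a. a \<in> insert m S \<Longrightarrow>
      poly (root_poly Y) a * poly (pderiv (root_poly (mset_set (insert m S)))) a < 0"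
  shows   "majorized X Y"
proof -
  define A where "A = insert m S"
  define F where "F = A \<union> set_mset X \<union> set_mset Y"
  define w where "w t = poly (root_poly (mset_set S)) t" for t
  have A: "finite A" "card A = card S + 1" "size X = Suc (card A)" "size Y = Suc (card A)"
    using S sz by (auto simp: A_def)
  have F: "finite F"
    using A by (simp add: F_def)
  have W: "poly (root_poly (mset_set A)) t = (t - m) * w t" for t
    using S by (simp add: A_def w_def algebra_simps)
  have Yt: "poly (root_poly Y) t = poly (root_poly X) t - \<eta> * w t" for t
    by (simp add: eq w_def)
  have cX: "size (filter_mset (\<lambda>x. x > t) X) = card {a \<in> A. a > t} +
      (if poly (root_poly X) t * ((t - m) * w t) < 0 then 1 else 0)" if "t \<notin> F" for t
    unfolding W[symmetric]
  proof (rule interlacing_count)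
    show "t \<notin> A" "t \<notin># X"
      using that by (simp_all add: F_def)
  qed (use A signX in \<open>simp_all only: A_def\<close>)
  have cY: "size (filter_mset (\<lambda>x. x > t) Y) = card {a \<in> A. a > t} +
      (if poly (root_poly Y) t * ((t - m) * w t) < 0 then 1 else 0)" if "t \<notin> F" for t
    unfolding W[symmetric]
  proof (rule interlacing_count)
    show "t \<notin> A" "t \<notin># Y"
      using that by (simp_all add: F_def)
  qed (use A signY in \<open>simp_all only: A_def\<close>)
  have diff: "poly (root_poly Y) t * ((t - m) * w t) =
      poly (root_poly X) t * ((t - m) * w t) - (t - m) * (\<eta> * (w t)\<^sup>2)" for t
    unfolding Yt by (simp add: algebra_simps power2_eq_square)
  have \<eta>': "0 \<le> \<eta> * (w t)\<^sup>2" for t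
    using \<eta> by simp
  have above: "size (filter_mset (\<lambda>x. x > t) X) \<le> size (filter_mset (\<lambda>y. y > t) Y)"
    if "m < t" "t \<notin> F" for t
  proof -
    have "0 \<le> (t - m) * (\<eta> * (w t)\<^sup>2)"
      using that(1) by (intro mult_nonneg_nonneg \<eta>') auto
    thus ?thesis
      using cX[OF that(2)] cY[OF that(2)] diff[of t] by (auto split: if_splits)
  qed
  have below: "size (filter_mset (\<lambda>x. x < t) X) \<le> size (filter_mset (\<lambda>y. y < t) Y)"
    if "t < m" "t \<notin> F" for t
  proof -
    have "(t - m) * (\<eta> * (w t)\<^sup>2) \<le> 0"
      using that(1) by (intro mult_nonpos_nonneg \<eta>') auto
    \<comment> \<open>Below \<open>m\<close> the counts of elements above \<open>t\<close> decrease;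
      equal sizes turn this into an increase of the counts below \<open>t\<close>.\<close>
    hence "size (filter_mset (\<lambda>y. y > t) Y) \<le> size (filter_mset (\<lambda>x. x > t) X)"
      using cX[OF that(2)] cY[OF that(2)] diff[of t] by (auto split: if_splits)
    moreover have "t \<notin># X" "t \<notin># Y"
      using that(2) by (auto simp: F_def)
    note size_filter_greater_less[OF this(1)] size_filter_greater_less[OF this(2)]
    ultimately show ?thesis
      using sz by linarith
  qed
  \<comment> \<open>The coefficient just below the leading one is minus the sum of the roots. The
    correction term has degree two less than the polynomials, so it leaves this coefficient
    unchanged.\<close>
  have sum: "coeff (root_poly Z) (Suc n) = - \<Sum>\<^sub># Z" if "size Z = n + 2" for Z n
    using that
  proof (induction Z arbitrary: n)
    case (add z Z)
    show ?case
    proof (cases n)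
      case 0
      with add.prems obtain z' where "Z = {#z'#}"
        using size_1_singleton_mset[of Z] by auto
      thus ?thesis by (simp add: 0)
    next
      case (Suc k)
      thus ?thesis
        using add coeff_root_poly_size[of Z] by simp
    qed
  qed auto
  have "coeff (root_poly (mset_set S)) (Suc (card S)) = 0"
    by (intro coeff_eq_0) simp
  hence sum_eq: "\<Sum>\<^sub># X = \<Sum>\<^sub># Y"
    using sum[OF sz(1)] sum[OF sz(2)] by (simp add: eq)
  show ?thesis
  proof (rule majorized_spread_from[where m = m and F = F])
    show "size X = size Y"
      by (simp only: sz)
  qed (fact sum_eq F above below)+
qed

section \<open>Derivatives of polynomials with real roots\<close>

lemma pderiv_linear_mult: "pderiv ([:- a, 1:] * p) = p + [:- a, 1:] * pderiv p"
  by (simp add: pderiv_mult pderiv_pCons add.commute del: mult_pCons_left)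

lemma smult_left_cancel: "c \<noteq> 0 \<Longrightarrow> smult c p = smult c q \<longleftrightarrow> p = (q :: 'a :: idom poly)"
  by (metis diff_eq_diff_eq right_minus_eq smult_diff_right smult_eq_0_iff)

lemma pderiv_root_poly_add_mset:
  "pderiv (root_poly (add_mset x X)) = root_poly X + [:- x, 1:] * pderiv (root_poly X)"
  unfolding root_poly_add_mset by (rule pderiv_linear_mult)

lemma poly_root_poly_add_mset: "poly (root_poly (add_mset x X)) t = (t - x) * poly (root_poly X) t"
  by (simp add: algebra_simps)

lemma poly_pderiv_root_poly_add_mset:
  "poly (pderiv (root_poly (add_mset x X))) t = poly (root_poly X) t + (t - x) * poly (pderiv (root_poly X)) t"
  by (simp add: pderiv_root_poly_add_mset algebra_simps del: root_poly_add_mset)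

lemma poly_pderiv2_root_poly_add_mset:
  "poly (pderiv (pderiv (root_poly (add_mset x X)))) t =
     2 * poly (pderiv (root_poly X)) t + (t - x) * poly (pderiv (pderiv (root_poly X))) t"
  unfolding pderiv_root_poly_add_mset pderiv_add pderiv_linear_mult by (simp add: algebra_simps)

text \<open>The logarithmic derivative is a sum of terms \<open>1 / (t - x)\<close> and so has
  negative derivative; this is cleared of denominators here. In the induction, a new root
  \<open>x\<close> multiplies the difference \<open>q'^2 - q q''\<close> by \<open>(t - x)^2\<close>
  and adds \<open>q^2\<close>, which gives strictness.\<close>

lemma laguerre_inequality:
  assumes "t \<notin># X" "X \<noteq> {#}"
  shows   "poly (root_poly X) t * poly (pderiv (pderiv (root_poly X))) t < (poly (pderiv (root_poly X)) t)\<^sup>2"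
  using assms
proof (induction X)
  case (add x X)
  let ?q = "root_poly X"
  have "poly ?q t * poly (pderiv (pderiv ?q)) t \<le> (poly (pderiv ?q) t)\<^sup>2"
    using add by (cases "X = {#}") (auto simp: pderiv_1)
  hence "(t - x)\<^sup>2 * (poly ?q t * poly (pderiv (pderiv ?q)) t) \<le> (t - x)\<^sup>2 * (poly (pderiv ?q) t)\<^sup>2"
    by (intro mult_left_mono) auto
  moreover have "0 < (poly ?q t)\<^sup>2"
    using add.prems by (simp add: poly_root_poly_eq_0_iff)
  ultimately have "(t - x)\<^sup>2 * (poly ?q t * poly (pderiv (pderiv ?q)) t) <
      (t - x)\<^sup>2 * (poly (pderiv ?q) t)\<^sup>2 + (poly ?q t)\<^sup>2"
    by linarith
  thus ?case
    unfolding poly_root_poly_add_mset poly_pderiv_root_poly_add_mset poly_pderiv2_root_poly_add_mset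
    by (simp add: power2_eq_square algebra_simps)
qed simp

text \<open>The witness is the sum of the \<open>1 / (z - x)\<close>. Each term has imaginary part
  of sign opposite to \<open>Im z\<close>, so nothing can cancel.\<close>

lemma logderiv_root_poly:
  assumes "Im z \<noteq> 0"
  obtains w where
    "poly (pderiv (map_poly complex_of_real (root_poly X))) z = poly (map_poly complex_of_real (root_poly X)) z * w"
    "X \<noteq> {#} \<Longrightarrow> Im z * Im w < 0" "X = {#} \<Longrightarrow> w = 0"
proof -
  have "\<exists>w. poly (pderiv (map_poly complex_of_real (root_poly X))) z =
      poly (map_poly complex_of_real (root_poly X)) z * w \<and>
      (X \<noteq> {#} \<longrightarrow> Im z * Im w < 0) \<and> (X = {#} \<longrightarrow> w = 0)"
  proof (induction X)
    case (add x X)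
    then obtain w where w: "poly (pderiv (map_poly complex_of_real (root_poly X))) z =
        poly (map_poly complex_of_real (root_poly X)) z * w"
        "X \<noteq> {#} \<longrightarrow> Im z * Im w < 0" "X = {#} \<longrightarrow> w = 0"
      by blast
    have nz: "z - of_real x \<noteq> 0"
      using assms by (auto simp: complex_eq_iff)
    have "Im z * Im (1 / (z - of_real x)) = - (Im z)\<^sup>2 / (norm (z - of_real x))\<^sup>2"
      by (simp add: Im_divide cmod_def power2_eq_square)
    also have "\<dots> < 0"
      using nz assms by (simp add: divide_neg_pos)
    finally have "Im z * Im (1 / (z - of_real x)) < 0" .
    moreover have "Im z * Im w \<le> 0"
      using w by (cases "X = {#}") auto
    ultimately have "Im z * Im (1 / (z - of_real x) + w) < 0"
      by (simp only: plus_complex.simps distrib_left)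
    moreover have "poly (pderiv (map_poly complex_of_real (root_poly (add_mset x X)))) z =
        poly (map_poly complex_of_real (root_poly (add_mset x X))) z * (1 / (z - of_real x) + w)"
    proof -
      have "map_poly complex_of_real (root_poly (add_mset x X)) =
          [:- of_real x, 1:] * map_poly complex_of_real (root_poly X)"
        unfolding root_poly_add_mset map_poly_of_real_mult by (simp add: map_poly_pCons)
      moreover have "P + (z - of_real x) * (P * w) = (z - of_real x) * P * (1 / (z - of_real x) + w)" for P
        using nz by (simp add: distrib_left)
      note this[of "poly (map_poly complex_of_real (root_poly X)) z"]
      moreover have "poly [:- of_real x, 1:] z = z - of_real x"
        by simp
      ultimately show ?thesis
        by (simp only: pderiv_linear_mult poly_add poly_mult w(1))
    qed
    ultimately show ?case
      by (intro exI[of _ "1 / (z - of_real x) + w"]) simp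
  qed (simp add: pderiv_1)
  thus thesis
    using that by blast
qed

lemma real_rooted_imp_root_poly:
  assumes "lead_coeff P > 0"
    and "\<And>z. poly (map_poly complex_of_real P) z = 0 \<Longrightarrow> z \<in> \<real>"
  shows   "P = smult (lead_coeff P) (root_poly (proots P))" "size (proots P) = degree P"
proof -
  let ?c = "lead_coeff P"
  have "smult (inverse ?c) P \<in> hyp_polys (degree P)"
    using assms by (auto simp: hyp_polys_def map_poly_of_real_smult)
  then obtain X where X: "smult (inverse ?c) P = root_poly X" "size X = degree P"
    by (elim hyp_polys_imp_root_poly)
  hence "smult ?c (smult (inverse ?c) P) = smult ?c (root_poly X)"
    by simp
  moreover have "?c * inverse ?c = 1"
    using assms(1) by (intro right_inverse) auto
  ultimately have P: "P = smult ?c (root_poly X)"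
    by (simp only: smult_smult smult_1_left)
  have "proots P = X"
    using assms(1) by (subst P, subst proots_smult) auto
  thus "P = smult (lead_coeff P) (root_poly (proots P))" "size (proots P) = degree P"
    using P X by simp_all
qed

text \<open>The case \<open>\<beta> = 0\<close>, \<open>\<alpha> = - 1\<close> is differentiation.\<close>

locale first_order_op =
  fixes \<alpha> \<beta> :: real
  assumes \<alpha>: "\<alpha> \<noteq> 0" and \<beta>: "\<beta> \<ge> 0" and \<alpha>\<beta>: "\<beta> = 0 \<Longrightarrow> \<alpha> < 0"
begin

definition T :: "real poly \<Rightarrow> real poly" where
  "T p = smult \<beta> p - smult \<alpha> (pderiv p)"

definition roots_T :: "real multiset \<Rightarrow> real multiset" where
  "roots_T X = proots (T (root_poly X))"

text \<open>The locale assumptions make this leading coefficient positive, except for constants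
  annihilated by \<open>T\<close>.\<close>

definition lead_T :: "nat \<Rightarrow> real" where
  "lead_T n = (if \<beta> = 0 then - \<alpha> * n else \<beta>)"

definition deg_T :: "nat \<Rightarrow> nat" where
  "deg_T n = (if \<beta> = 0 then n - 1 else n)"

lemma lead_T_pos: "\<beta> \<noteq> 0 \<or> n > 0 \<Longrightarrow> lead_T n > 0"
  using \<alpha>\<beta> \<beta> by (auto simp: lead_T_def mult_neg_pos)

text \<open>At a nonreal root of the image, dividing by the nonzero value of
  \<open>root_poly X\<close> leaves \<open>\<alpha> * w = \<beta>\<close> with \<open>w\<close> the
  logarithmic derivative. As \<open>\<alpha>\<close> is real and nonzero, \<open>w\<close> is real,
  so \<open>X\<close> is empty; then \<open>w = 0\<close> contradicts
  \<open>\<beta> \<noteq> 0\<close>.\<close>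

lemma T_root_poly:
  assumes "\<beta> \<noteq> 0 \<or> X \<noteq> {#}"
  shows   "T (root_poly X) = smult (lead_T (size X)) (root_poly (roots_T X))"
    and   "size (roots_T X) = deg_T (size X)"
proof -
  let ?P = "T (root_poly X)"
  have c: "coeff ?P (deg_T (size X)) = lead_T (size X)"
  proof (cases "\<beta> = 0")
    case True
    then obtain k where "size X = Suc k"
      using assms by (cases "size X") auto
    thus ?thesis
      using True coeff_root_poly_size[of X] unfolding T_def deg_T_def lead_T_def
      by (simp add: coeff_pderiv)
  qed (simp add: T_def deg_T_def lead_T_def coeff_pderiv coeff_eq_0)
  have pos: "lead_T (size X) > 0"
    using assms by (intro lead_T_pos) (auto simp: nonempty_has_size[symmetric])
  have "degree ?P \<le> deg_T (size X)"
    unfolding T_def deg_T_def by (auto intro!: degree_diff_le simp: degree_pderiv)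
  hence deg: "degree ?P = deg_T (size X)"
    using c pos le_degree[of ?P "deg_T (size X)"] by simp
  hence lead: "lead_coeff ?P = lead_T (size X)"
    using c by simp
  have real: "z \<in> \<real>" if z: "poly (map_poly complex_of_real ?P) z = 0" for z
  proof (rule ccontr)
    assume "z \<notin> \<real>"
    hence Im: "Im z \<noteq> 0"
      by (simp add: complex_is_Real_iff)
    let ?p = "poly (map_poly complex_of_real (root_poly X)) z"
    obtain w where w: "poly (pderiv (map_poly complex_of_real (root_poly X))) z = ?p * w"
      "X \<noteq> {#} \<Longrightarrow> Im z * Im w < 0" "X = {#} \<Longrightarrow> w = 0"
      using logderiv_root_poly[OF Im] by blast
    have "?p \<noteq> 0"
      using root_poly_in_hyp_polys[of X] \<open>z \<notin> \<real>\<close> by (auto simp: hyp_polys_def)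
    moreover have "?p * (of_real \<beta> - of_real \<alpha> * w) = 0"
      using z by (simp add: T_def map_poly_of_real_diff map_poly_of_real_smult map_poly_of_real_pderiv
          w(1) algebra_simps)
    ultimately have eq: "of_real \<alpha> * w = of_real \<beta>"
      by simp
    hence "Im (of_real \<alpha> * w) = Im (of_real \<beta>)"
      by (simp only:)
    hence "\<alpha> * Im w = 0"
      by simp
    hence "X = {#}"
      using \<alpha> w(2) by auto
    thus False
      using eq w(3) assms by simp
  qed
  show "T (root_poly X) = smult (lead_T (size X)) (root_poly (roots_T X))"
       "size (roots_T X) = deg_T (size X)"
    using real_rooted_imp_root_poly[of ?P] real lead pos deg by (simp_all add: roots_T_def)
qed

lemma poly_T_quadratic:
  "poly (T (root_poly (add_mset (m + d) (add_mset (m - d) Z)))) t =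
     ((t - m)\<^sup>2 - d\<^sup>2) * poly (T (root_poly Z)) t - 2 * \<alpha> * (t - m) * poly (root_poly Z) t"
  unfolding T_def poly_diff poly_smult poly_root_poly_add_mset poly_pderiv_root_poly_add_mset
  by (simp add: algebra_simps power2_eq_square)

text \<open>At a root of \<open>T r\<close> the relation \<open>\<beta> r = \<alpha> r'\<close>
  rewrites the product as \<open>\<alpha>^2 (r'^2 - r r'')\<close>. Laguerre's inequality applies,
  because a common root of \<open>r\<close> and \<open>T r\<close> would be a double root of
  \<open>r\<close>, but \<open>Z\<close> is a set. The result gives both simplicity of the roots of
  \<open>T r\<close> and the sign needed for interlacing.\<close>

lemma roots_T_simple:
  assumes Z: "finite Z" "Z \<noteq> {}"
    and t: "poly (T (root_poly (mset_set Z))) t = 0"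
  shows   "0 < \<alpha> * poly (root_poly (mset_set Z)) t * poly (pderiv (T (root_poly (mset_set Z)))) t"
proof -
  let ?r = "root_poly (mset_set Z)"
  have r0: "\<beta> * poly ?r t = \<alpha> * poly (pderiv ?r) t"
    using t by (simp add: T_def)
  have "t \<notin> Z"
  proof
    assume "t \<in> Z"
    hence Zt: "mset_set Z = add_mset t (mset_set (Z - {t}))"
      using Z by (simp add: mset_set.remove)
    have "poly ?r t = 0"
      using \<open>t \<in> Z\<close> Z by (simp add: poly_root_poly_eq_0_iff)
    hence "poly (pderiv ?r) t = 0"
      using r0 \<alpha> by simp
    hence "poly (root_poly (mset_set (Z - {t}))) t = 0"
      unfolding Zt poly_pderiv_root_poly_same .
    thus False
      using Z by (simp add: poly_root_poly_eq_0_iff)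
  qed
  have "mset_set Z \<noteq> {#}"
    using Z by (simp add: mset_set_empty_iff)
  hence "poly ?r t * poly (pderiv (pderiv ?r)) t < (poly (pderiv ?r) t)\<^sup>2"
    using Z \<open>t \<notin> Z\<close> by (intro laguerre_inequality) auto
  hence "0 < \<alpha>\<^sup>2 * ((poly (pderiv ?r) t)\<^sup>2 - poly ?r t * poly (pderiv (pderiv ?r)) t)"
    using \<alpha> by simp
  also have "\<dots> = (\<alpha> * poly (pderiv ?r) t) * (\<alpha> * poly (pderiv ?r) t) -
      \<alpha>\<^sup>2 * poly ?r t * poly (pderiv (pderiv ?r)) t"
    by (simp add: algebra_simps power2_eq_square)
  also have "\<dots> = (\<beta> * poly ?r t) * (\<alpha> * poly (pderiv ?r) t) -
      \<alpha>\<^sup>2 * poly ?r t * poly (pderiv (pderiv ?r)) t"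
    by (simp only: r0)
  also have "\<dots> = \<alpha> * poly ?r t * poly (pderiv (T ?r)) t"
    by (simp add: T_def pderiv_diff pderiv_smult algebra_simps power2_eq_square)
  finally show ?thesis .
qed

text \<open>The generic case: simple roots of \<open>r\<close> make those of \<open>T r\<close>
  simple, \<open>m\<close> is not among them, and \<open>d\<close> is positive, so the interlacing
  signs on \<open>insert m S\<close> are strict.\<close>

lemma majorized_roots_T_generic:
  assumes Z: "finite Z" and m: "poly (T (root_poly (mset_set Z))) m \<noteq> 0" and de: "0 < d" "d \<le> e"
  defines "X \<equiv> \<lambda>d. add_mset (m + d) (add_mset (m - d) (mset_set Z))"
  shows   "majorized (roots_T (X d)) (roots_T (X e))"
proof -
  let ?r = "root_poly (mset_set Z)"
  define S where "S = set_mset (roots_T (mset_set Z))"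
  define c where "c = lead_T (card Z)"
  define c' where "c' = lead_T (card Z + 2)"
  have nz: "\<beta> \<noteq> 0 \<or> mset_set Z \<noteq> {#}"
    using m by (auto simp: T_def pderiv_1)
  hence c: "c > 0" "c' > 0"
    using lead_T_pos[of "card Z"] lead_T_pos[of "card Z + 2"] Z
    by (auto simp: c_def c'_def mset_set_empty_iff card_gt_0_iff)
  have s: "T ?r = smult c (root_poly (roots_T (mset_set Z)))"
    using T_root_poly(1)[OF nz] by (simp add: c_def)
  have T_X: "T (root_poly (X d)) = smult c' (root_poly (roots_T (X d)))" for d
    using T_root_poly(1)[of "X d"] by (simp add: X_def c'_def)
  have mS: "m \<notin> S"
    using m c by (simp add: s poly_root_poly_eq_0_iff S_def)
  have S0: "poly (T ?r) t = 0 \<longleftrightarrow> t \<in> S" for t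
    using c by (simp add: s poly_root_poly_eq_0_iff S_def)
  have simple: "0 < \<alpha> * poly ?r a * poly (pderiv (T ?r)) a" if "a \<in> S" for a
  proof (rule roots_T_simple[OF Z])
    show "Z \<noteq> {}"
    proof
      assume "Z = {}"
      hence "roots_T (mset_set Z) = {#}"
        using T_root_poly(2)[OF nz] by (simp add: deg_T_def split: if_splits)
      thus False
        using that by (simp add: S_def)
    qed
  qed (use that S0 in blast)
  \<comment> \<open>At a repeated root of \<open>T r\<close> the derivative would vanish, against
    \<open>simple\<close>.\<close>
  have msetS: "mset_set S = roots_T (mset_set Z)"
  proof -
    have "count (roots_T (mset_set Z)) a = 1" if a: "a \<in> S" for a
    proof (rule ccontr)
      let ?M = "roots_T (mset_set Z)"
      assume "count ?M a \<noteq> 1"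
      moreover have "count ?M a > 0"
        using a by (simp add: S_def)
      ultimately have "a \<in># ?M - {#a#}"
        by (simp add: count_greater_zero_iff[symmetric] del: count_greater_zero_iff)
      hence "poly (root_poly (?M - {#a#})) a = 0"
        by (simp add: poly_root_poly_eq_0_iff)
      moreover have "?M = add_mset a (?M - {#a#})"
        using a by (simp add: S_def)
      ultimately have "poly (pderiv (root_poly ?M)) a = 0"
        by (metis poly_pderiv_root_poly_same)
      thus False
        using simple[OF a] by (simp add: s pderiv_smult)
    qed
    thus ?thesis
      by (intro multiset_eqI) (auto simp: count_mset_set' S_def count_eq_zero_iff)
  qed
  have T_r: "T ?r = smult c (root_poly (mset_set S))"
    using s msetS by simp
  have poly_T_X: "poly (T (root_poly (X d))) t = ((t - m)\<^sup>2 - d\<^sup>2) * poly (T ?r) t - 2 * \<alpha> * (t - m) * poly ?r t"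
    for d t
    unfolding X_def by (rule poly_T_quadratic)
  have finS: "finite S"
    by (simp add: S_def)
  have "mset_set (insert m S) = add_mset m (mset_set S)"
    using mS finS by simp
  hence pderiv_W: "pderiv (root_poly (mset_set (insert m S))) =
      root_poly (mset_set S) + [:- m, 1:] * pderiv (root_poly (mset_set S))"
    by (simp add: pderiv_mult pderiv_pCons del: mult_pCons_left)
  have sign: "poly (root_poly (roots_T (X d))) a * poly (pderiv (root_poly (mset_set (insert m S)))) a < 0"
    if "a \<in> insert m S" "d > 0" for a d
  proof -
    \<comment> \<open>As \<open>c\<close> and \<open>c'\<close> are positive, signs can be read off
      the unnormalized polynomials. The product is \<open>- d^2 (T r)(m)^2\<close> at
      \<open>m\<close> and \<open>- 2 \<alpha> (a - m)^2 r(a) (T r)'(a)\<close> at a root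
      \<open>a\<close> of \<open>T r\<close>.\<close>
    have "c' * poly (root_poly (roots_T (X d))) a * (c * poly (pderiv (root_poly (mset_set (insert m S)))) a) =
        poly (T (root_poly (X d))) a * (poly (T ?r) a + (a - m) * poly (pderiv (T ?r)) a)"
      unfolding T_X T_r pderiv_W by (simp add: pderiv_smult algebra_simps)
    also have "\<dots> < 0"
    proof (cases "a = m")
      case True
      have "- (d * poly (T ?r) m)\<^sup>2 < 0"
        using m that by simp
      thus ?thesis
        by (simp add: poly_T_X True power2_eq_square algebra_simps)
    next
      case False
      hence a: "a \<in> S" "poly (T ?r) a = 0"
        using that S0 by auto
      have "- 2 * ((a - m)\<^sup>2 * (\<alpha> * poly ?r a * poly (pderiv (T ?r)) a)) < 0"
        using False simple[OF a(1)] by simp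
      thus ?thesis
        by (simp add: poly_T_X a power2_eq_square algebra_simps)
    qed
    finally show ?thesis
      using c by (simp add: mult_less_0_iff zero_less_mult_iff)
  qed
  show ?thesis
  proof (rule majorized_interlaced[OF finS mS])
    \<comment> \<open>By \<open>poly_T_quadratic\<close>, passing from \<open>d\<close> to
      \<open>e\<close> subtracts \<open>(e^2 - d^2) T r\<close>; normalizing to monic polynomials
      brings in the factor \<open>c / c'\<close>.\<close>
    have "smult c' (root_poly (roots_T (X e))) =
        smult c' (root_poly (roots_T (X d)) - smult ((e\<^sup>2 - d\<^sup>2) * c / c') (root_poly (mset_set S)))"
    proof (rule poly_eq_poly_eq_iff[THEN iffD1], rule ext)
      fix t
      have "c' * poly (root_poly (roots_T (X d))) t = poly (T (root_poly (X d))) t" for d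
        by (simp add: T_X)
      thus "poly (smult c' (root_poly (roots_T (X e)))) t =
          poly (smult c' (root_poly (roots_T (X d)) - smult ((e\<^sup>2 - d\<^sup>2) * c / c') (root_poly (mset_set S)))) t"
        using c by (simp add: right_diff_distrib poly_T_X T_r) (simp add: algebra_simps)
    qed
    thus "root_poly (roots_T (X e)) =
        root_poly (roots_T (X d)) - smult ((e\<^sup>2 - d\<^sup>2) * c / c') (root_poly (mset_set S))"
      using c(2) by (subst (asm) smult_left_cancel) auto
    show "0 \<le> (e\<^sup>2 - d\<^sup>2) * c / c'"
      using c de by (simp add: power_mono)
    have "card S = deg_T (card Z)"
      using T_root_poly(2)[OF nz] msetS by (metis size_mset_set)
    moreover have "deg_T (card Z + 2) = deg_T (card Z) + 2"
      using nz Z by (auto simp: deg_T_def mset_set_empty_iff card_gt_0_iff)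
    ultimately show "size (roots_T (X d)) = card S + 2" "size (roots_T (X e)) = card S + 2"
      using T_root_poly(2)[of "X d"] T_root_poly(2)[of "X e"] by (simp_all add: X_def)
  qed (use sign de in auto)
qed

end

section \<open>Operators given by power series\<close>

lemma coeffs_tendsto_root_poly_add_mset:
  assumes "x \<longlonglongrightarrow> y" "coeffs_tendsto (\<lambda>N. root_poly (X N)) (root_poly Y)"
  shows   "coeffs_tendsto (\<lambda>N. root_poly (add_mset (x N) (X N))) (root_poly (add_mset y Y))"
  unfolding root_poly_add_mset
  by (intro coeffs_tendsto_mult coeffs_tendsto_pCons coeffs_tendsto_const tendsto_minus assms)

lemma eventually_notin_finite:
  assumes "finite F" "x \<longlonglongrightarrow> y" "\<And>N. x N \<noteq> (y::real)"
  shows   "\<forall>\<^sub>F N in sequentially. x N \<notin> F"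
proof -
  have "\<forall>\<^sub>F N in sequentially. x N \<noteq> a" if "a \<in> F" for a
  proof (cases "a = y")
    case False
    thus ?thesis
      using tendsto_imp_eventually_ne[OF assms(2), of a] by auto
  qed (use assms(3) in simp)
  hence "\<forall>\<^sub>F N in sequentially. \<forall>a\<in>F. x N \<noteq> a"
    using assms(1) by (simp add: eventually_ball_finite)
  thus ?thesis
    by eventually_elim auto
qed

context first_order_op
begin

lemma coeffs_tendsto_T: "coeffs_tendsto P p \<Longrightarrow> coeffs_tendsto (\<lambda>N. T (P N)) (T p)"
  unfolding T_def
  by (intro coeffs_tendsto_diff coeffs_tendsto_smult coeffs_tendsto_pderiv tendsto_const)

text \<open>For a fixed positive size, \<open>lead_T n\<close> is one nonzero constant along the
  sequence, so the normalized image depends continuously on the coefficients.\<close>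

lemma majorized_roots_T_limit:
  assumes X: "coeffs_tendsto (\<lambda>N. root_poly (X N)) (root_poly X')" "\<And>N. size (X N) = n" "size X' = n"
    and Y: "coeffs_tendsto (\<lambda>N. root_poly (Y N)) (root_poly Y')" "\<And>N. size (Y N) = n" "size Y' = n"
    and n: "n > 0" and maj: "\<forall>\<^sub>F N in sequentially. majorized (roots_T (X N)) (roots_T (Y N))"
  shows   "majorized (roots_T X') (roots_T Y')"
proof -
  have nz: "\<beta> \<noteq> 0 \<or> Z \<noteq> {#}" if "size Z = n" for Z :: "real multiset"
    using n that by auto
  have eq: "root_poly (roots_T Z) = smult (inverse (lead_T n)) (T (root_poly Z))" if "size Z = n" for Z
  proof -
    have "lead_T n \<noteq> 0"
      using lead_T_pos[of n] n by simp
    thus ?thesis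
      unfolding T_root_poly(1)[OF nz[OF that]] that by simp
  qed
  show ?thesis
  proof (rule majorized_limit[OF _ _ _ _ maj])
    show "coeffs_tendsto (\<lambda>N. root_poly (roots_T (X N))) (root_poly (roots_T X'))"
      unfolding eq[OF X(2)] eq[OF X(3)]
      by (intro coeffs_tendsto_smult coeffs_tendsto_T tendsto_const X(1))
    show "coeffs_tendsto (\<lambda>N. root_poly (roots_T (Y N))) (root_poly (roots_T Y'))"
      unfolding eq[OF Y(2)] eq[OF Y(3)]
      by (intro coeffs_tendsto_smult coeffs_tendsto_T tendsto_const Y(1))
    show "size (roots_T (X N)) = size (roots_T X')" "size (roots_T (Y N)) = size (roots_T Y')" for N
      using X(2,3) Y(2,3) nz by (simp_all add: T_root_poly(2))
  qed
qed

lemma majorized_roots_T_distinct: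
  assumes Z: "finite Z" "\<beta> \<noteq> 0 \<or> Z \<noteq> {}" and de: "0 \<le> d" "d \<le> e"
  shows   "majorized (roots_T (add_mset (m + d) (add_mset (m - d) (mset_set Z))))
                     (roots_T (add_mset (m + e) (add_mset (m - e) (mset_set Z))))"
proof -
  let ?r = "root_poly (mset_set Z)"
  \<comment> \<open>Adding \<open>h N\<close> to \<open>m\<close>, \<open>d\<close> and
    \<open>e\<close> alike keeps \<open>d \<le> e\<close>, makes \<open>d\<close> positive, and
    moves \<open>m\<close> off the finitely many roots of \<open>T r\<close> for large
    \<open>N\<close>.\<close>
  define h where "h N = 1 / real (Suc N)" for N
  have h: "h N > 0" for N
    by (simp add: h_def)
  have h_lim: "h \<longlonglongrightarrow> 0"
    unfolding h_def by (rule LIMSEQ_inverse_real_of_nat[unfolded inverse_eq_divide])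
  have lim: "(\<lambda>N. x + h N) \<longlonglongrightarrow> x" for x
    using tendsto_add[OF tendsto_const h_lim, of x] by simp
  have "T ?r \<noteq> 0"
  proof -
    have nz: "\<beta> \<noteq> 0 \<or> mset_set Z \<noteq> {#}"
      using Z by (auto simp: mset_set_empty_iff)
    moreover have "lead_T (card Z) > 0"
      using Z by (intro lead_T_pos) (auto simp: card_gt_0_iff)
    ultimately show ?thesis
      using T_root_poly(1)[OF nz] by simp
  qed
  hence "finite {t. poly (T ?r) t = 0}"
    by (rule poly_roots_finite)
  hence "\<forall>\<^sub>F N in sequentially. m + h N \<notin> {t. poly (T ?r) t = 0}"
    by (rule eventually_notin_finite[OF _ lim]) (use h in \<open>simp add: less_imp_neq[symmetric]\<close>)
  hence maj: "\<forall>\<^sub>F N in sequentially.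
      majorized (roots_T (add_mset ((m + h N) + (d + h N)) (add_mset ((m + h N) - (d + h N)) (mset_set Z))))
                (roots_T (add_mset ((m + h N) + (e + h N)) (add_mset ((m + h N) - (e + h N)) (mset_set Z))))"
  proof eventually_elim
    case (elim N)
    have "0 < d + h N" "d + h N \<le> e + h N"
      using de h[of N] by auto
    moreover have "poly (T ?r) (m + h N) \<noteq> 0"
      using elim by simp
    ultimately show ?case
      by (intro majorized_roots_T_generic Z)
  qed
  show ?thesis
    by (rule majorized_roots_T_limit[OF _ _ _ _ _ _ _ maj, where n = "card Z + 2"])
       (simp_all only: size_add_mset size_mset_set add_2_eq_Suc' zero_less_Suc,
        (intro coeffs_tendsto_root_poly_add_mset tendsto_add tendsto_diff lim coeffs_tendsto_const)+)
qed

lemma majorized_roots_T_transfer: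
  assumes de: "0 \<le> d" "d \<le> e"
  shows   "majorized (roots_T (add_mset (m + d) (add_mset (m - d) Z)))
                     (roots_T (add_mset (m + e) (add_mset (m - e) Z)))"
proof (cases "\<beta> = 0 \<and> Z = {#}")
  \<comment> \<open>A multiple of differentiation with no further roots: \<open>T r = 0\<close>, so
    by \<open>poly_T_quadratic\<close> the image of \<open>(t - m)^2 - d^2\<close> does not depend
    on \<open>d\<close>.\<close>
  case True
  have T0: "T (root_poly Z) = 0"
    unfolding T_def using True by (simp add: pderiv_1)
  have "poly (T (root_poly (add_mset (m + d) (add_mset (m - d) Z)))) t =
        poly (T (root_poly (add_mset (m + e) (add_mset (m - e) Z)))) t" for t
    unfolding poly_T_quadratic T0 by simp
  hence "T (root_poly (add_mset (m + d) (add_mset (m - d) Z))) =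
         T (root_poly (add_mset (m + e) (add_mset (m - e) Z)))"
    by (intro poly_eq_poly_eq_iff[THEN iffD1] ext)
  thus ?thesis
    by (simp only: roots_T_def majorized_refl)
next
  case False
  obtain zs where zs: "Z = mset zs"
    by (metis ex_mset)
  let ?I = "{..<length zs}"
  \<comment> \<open>Shifting entry \<open>i\<close> by \<open>i / (N + 1)\<close> separates equal
    entries at once, while unequal ones stay apart for large \<open>N\<close>.\<close>
  define z where "z N i = zs ! i + real i * (1 / real (Suc N))" for N i
  have lim: "(\<lambda>N. z N i) \<longlonglongrightarrow> zs ! i" for i
    using tendsto_add[OF tendsto_const tendsto_mult[OF tendsto_const[of "real i"]
      LIMSEQ_inverse_real_of_nat[unfolded inverse_eq_divide]], of "zs ! i"] by (simp add: z_def)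
  have "\<forall>\<^sub>F N in sequentially. z N i \<noteq> z N j" if "i \<noteq> j" for i j
  proof (cases "zs ! i = zs ! j")
    case True
    thus ?thesis
      using that by (simp add: z_def)
  next
    case False
    hence "\<forall>\<^sub>F N in sequentially. z N i - z N j \<noteq> 0"
      by (intro tendsto_imp_eventually_ne[OF tendsto_diff[OF lim lim]]) simp
    thus ?thesis
      by eventually_elim simp
  qed
  hence "\<forall>\<^sub>F N in sequentially. \<forall>i\<in>?I. \<forall>j\<in>?I. i \<noteq> j \<longrightarrow> z N i \<noteq> z N j"
    by (intro eventually_ball_finite ballI finite_lessThan) (auto intro: eventually_mono)
  hence inj: "\<forall>\<^sub>F N in sequentially. inj_on (z N) ?I"
    by eventually_elim (auto simp: inj_on_def)
  have maj: "\<forall>\<^sub>F N in sequentially. majorized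
      (roots_T (add_mset (m + d) (add_mset (m - d) (image_mset (z N) (mset_set ?I)))))
      (roots_T (add_mset (m + e) (add_mset (m - e) (image_mset (z N) (mset_set ?I)))))"
    using inj
  proof eventually_elim
    case (elim N)
    have "z N ` ?I = {} \<longleftrightarrow> Z = {#}"
      by (simp add: zs lessThan_empty_iff)
    hence "\<beta> \<noteq> 0 \<or> z N ` ?I \<noteq> {}"
      using False by blast
    thus ?case
      unfolding image_mset_mset_set[OF elim] by (intro majorized_roots_T_distinct de) auto
  qed
  have Z: "Z = image_mset ((!) zs) (mset_set ?I)"
    by (metis mset_map map_nth mset_upt atLeast0LessThan zs)
  have "coeffs_tendsto (\<lambda>N. root_poly (image_mset (z N) (mset_set ?I))) (root_poly Z)"
    unfolding Z by (intro coeffs_tendsto_root_poly_image lim)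
  note * = coeffs_tendsto_root_poly_add_mset[OF tendsto_const coeffs_tendsto_root_poly_add_mset[OF tendsto_const this]]
  show ?thesis
    by (rule majorized_roots_T_limit[OF * _ _ * _ _ _ maj, where n = "length zs + 2"])
       (simp_all add: zs)
qed

lemma majorized_roots_T:
  assumes "majorized X Y"
  shows   "majorized (roots_T X) (roots_T Y)"
  by (rule majorized_transfer_induct[OF _ _ _ assms, where le = "\<lambda>X Y. majorized (roots_T X) (roots_T Y)"])
     (blast intro: majorized_refl majorized_trans majorized_roots_T_transfer)+

end

section \<open>Differential operators as formal power series\<close>

text \<open>A formal counterpart of \<open>diff_op\<close>: products of series become compositions
  of operators, so \<open>\<phi>\<close> can be treated factor by factor.\<close>

definition fps_op :: "real fps \<Rightarrow> real poly \<Rightarrow> real poly" where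
  "fps_op A P = (\<Sum>k\<le>degree P. smult (fps_nth A k) ((pderiv ^^ k) P))"

lemma funpow_pderiv_eq_0:
  fixes P :: "real poly"
  assumes "degree P < k"
  shows   "(pderiv ^^ k) P = 0"
proof -
  have "degree ((pderiv ^^ k) P) = degree P - k" for k
    by (induction k) (simp_all add: degree_pderiv)
  hence "(pderiv ^^ degree P) P = [:coeff ((pderiv ^^ degree P) P) 0:]"
    by (metis degree_eq_zeroE diff_self_eq_0 coeff_pCons_0)
  hence "(pderiv ^^ Suc (degree P)) P = 0"
    by (metis funpow.simps(2) o_apply pderiv_singleton)
  moreover have "(pderiv ^^ i) 0 = (0 :: real poly)" for i
    by (induction i) simp_all
  moreover obtain i where "k = i + Suc (degree P)"
    using assms by (metis Suc_leI add.commute le_Suc_ex)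
  ultimately show ?thesis
    by (metis funpow_add o_apply)
qed

lemma fps_op_altdef:
  assumes "degree P \<le> n"
  shows   "fps_op A P = (\<Sum>k\<le>n. smult (fps_nth A k) ((pderiv ^^ k) P))"
  unfolding fps_op_def
  by (intro sum.mono_neutral_left) (use assms in \<open>auto simp: funpow_pderiv_eq_0\<close>)

lemma degree_funpow_pderiv_le: "degree ((pderiv ^^ k) P) \<le> degree (P :: real poly)"
  by (induction k) (simp_all add: degree_pderiv)

lemma degree_fps_op_le: "degree (fps_op A P) \<le> degree P"
  unfolding fps_op_def
  by (intro degree_sum_le order.trans[OF degree_smult_le degree_funpow_pderiv_le]) auto

lemma pderiv_sum: "pderiv (\<Sum>i\<in>I. f i) = (\<Sum>i\<in>I. pderiv (f i))"
  by (induction I rule: infinite_finite_induct) (simp_all add: pderiv_add)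

lemma smult_sum_right: "smult c (\<Sum>i\<in>I. f i) = (\<Sum>i\<in>I. smult c (f i))"
  by (rule poly_eqI) (simp add: coeff_sum sum_distrib_left)

lemma funpow_pderiv_sum: "(pderiv ^^ k) (\<Sum>i\<in>I. f i) = (\<Sum>i\<in>I. (pderiv ^^ k) (f i))"
  by (induction k) (simp_all add: pderiv_sum)

lemma funpow_pderiv_smult: "(pderiv ^^ k) (smult c p) = smult c ((pderiv ^^ k) p)"
  by (induction k) (simp_all add: pderiv_smult)

lemma fps_op_mult: "fps_op (A * B) P = fps_op A (fps_op B P)"
proof -
  let ?n = "degree P"
  let ?D = "\<lambda>k. (pderiv ^^ k) P"
  let ?g = "\<lambda>i j. smult (fps_nth A i * fps_nth B j) (?D (i + j))"
  have "fps_op A (fps_op B P) = (\<Sum>i\<le>?n. smult (fps_nth A i) ((pderiv ^^ i) (fps_op B P)))"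
    by (rule fps_op_altdef[OF degree_fps_op_le])
  also have "\<dots> = (\<Sum>i\<le>?n. \<Sum>j\<le>?n. ?g i j)"
    unfolding fps_op_def[of B] funpow_pderiv_sum funpow_pderiv_smult
    by (simp add: smult_sum_right funpow_add)
  also have "\<dots> = (\<Sum>(i,j)\<in>{..?n}\<times>{..?n}. ?g i j)"
    by (simp add: sum.cartesian_product)
  \<comment> \<open>Derivatives of order beyond the degree vanish, which cuts the square down to the
    triangle of the Cauchy product.\<close>
  also have "\<dots> = (\<Sum>(i,j)\<in>{(i,j). i + j \<le> ?n}. ?g i j)"
    by (intro sum.mono_neutral_right) (auto, metis funpow_pderiv_eq_0 not_le_imp_less)
  also have "\<dots> = (\<Sum>k\<le>?n. \<Sum>i\<le>k. ?g i (k - i))"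
    by (rule sum.triangle_reindex_eq)
  also have "\<dots> = (\<Sum>k\<le>?n. smult (fps_nth (A * B) k) (?D k))"
    by (intro sum.cong refl) (simp add: fps_mult_nth smult_sum atLeast0AtMost)
  finally show ?thesis
    by (simp add: fps_op_def)
qed

lemma fps_op_smult: "fps_op (fps_const c * A) P = smult c (fps_op A P)"
  by (simp add: fps_op_def smult_sum_right)

lemma fps_op_X_power: "fps_op (fps_X ^ m) P = (pderiv ^^ m) P"
proof -
  have "fps_op (fps_X ^ m) P = (\<Sum>k\<le>max m (degree P). if k = m then (pderiv ^^ k) P else 0)"
    by (subst fps_op_altdef[of _ "max m (degree P)"], simp, intro sum.cong) (auto simp: fps_X_power_nth)
  thus ?thesis
    by simp
qed

text \<open>Images stay monic of the same degree, so the class is closed under products and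
  coefficientwise limits; \<open>fps_X\<close> is outside it, as differentiation lowers the
  degree.\<close>

definition spectral_isotone :: "real fps \<Rightarrow> bool" where
  "spectral_isotone A \<longleftrightarrow>
     (\<forall>X. \<exists>Y. fps_op A (root_poly X) = root_poly Y \<and> size Y = size X) \<and>
     (\<forall>X Y. majorized X Y \<longrightarrow>
        majorized (proots (fps_op A (root_poly X))) (proots (fps_op A (root_poly Y))))"

lemma spectral_isotoneE:
  assumes "spectral_isotone A"
  obtains Y where "fps_op A (root_poly X) = root_poly Y" "size Y = size X"
  using assms unfolding spectral_isotone_def by blast

lemma spectral_isotoneD:
  "spectral_isotone A \<Longrightarrow> majorized X Y \<Longrightarrow>
     majorized (proots (fps_op A (root_poly X))) (proots (fps_op A (root_poly Y)))"
  unfolding spectral_isotone_def by blast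

lemma spectral_isotone_1: "spectral_isotone 1"
proof -
  have "fps_op 1 P = P" for P
    using fps_op_X_power[of 0 P] by simp
  thus ?thesis
    by (auto simp: spectral_isotone_def)
qed

lemma spectral_isotone_mult:
  assumes A: "spectral_isotone A" and B: "spectral_isotone B"
  shows   "spectral_isotone (A * B)"
  unfolding spectral_isotone_def fps_op_mult
proof (intro conjI allI impI)
  fix X
  obtain Y where Y: "fps_op B (root_poly X) = root_poly Y" "size Y = size X"
    using spectral_isotoneE[OF B] .
  obtain Z where "fps_op A (root_poly Y) = root_poly Z" "size Z = size Y"
    using spectral_isotoneE[OF A] .
  thus "\<exists>Y. fps_op A (fps_op B (root_poly X)) = root_poly Y \<and> size Y = size X"
    using Y by auto
next
  fix X Y assume maj: "majorized X Y"
  obtain X' where X': "fps_op B (root_poly X) = root_poly X'"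
    using spectral_isotoneE[OF B] .
  obtain Y' where Y': "fps_op B (root_poly Y) = root_poly Y'"
    using spectral_isotoneE[OF B] .
  have "majorized X' Y'"
    using spectral_isotoneD[OF B maj] by (simp add: X' Y')
  thus "majorized (proots (fps_op A (fps_op B (root_poly X)))) (proots (fps_op A (fps_op B (root_poly Y))))"
    unfolding X' Y' by (rule spectral_isotoneD[OF A])
qed

lemma spectral_isotone_power: "spectral_isotone A \<Longrightarrow> spectral_isotone (A ^ n)"
  by (induction n) (simp_all add: spectral_isotone_1 spectral_isotone_mult)

lemma spectral_isotone_prod:
  "(\<And>i. i \<in> I \<Longrightarrow> spectral_isotone (A i)) \<Longrightarrow> spectral_isotone (\<Prod>i\<in>I. A i)"
  by (induction I rule: infinite_finite_induct) (simp_all add: spectral_isotone_1 spectral_isotone_mult)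

text \<open>Only finitely many coefficients of the series act on a given polynomial, so the images
  converge coefficientwise; both real-rootedness and majorization pass to such limits.\<close>

lemma spectral_isotone_limit:
  assumes A: "\<And>N. spectral_isotone (A N)" and lim: "\<And>k. (\<lambda>N. fps_nth (A N) k) \<longlonglongrightarrow> fps_nth B k"
  shows   "spectral_isotone B"
proof -
  have *: "coeffs_tendsto (\<lambda>N. fps_op (A N) P) (fps_op B P)" for P
    unfolding fps_op_def by (intro coeffs_tendsto_sum coeffs_tendsto_smult coeffs_tendsto_const lim)
  have "\<exists>Y. fps_op (A N) (root_poly X) = root_poly Y \<and> size Y = size X" for N X
    using spectral_isotoneE[OF A] by metis
  then obtain R where R: "\<And>N X. fps_op (A N) (root_poly X) = root_poly (R N X)" "\<And>N X. size (R N X) = size X"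
    by metis
  have "\<exists>Y. fps_op B (root_poly X) = root_poly Y \<and> size Y = size X" for X
  proof -
    have "coeffs_tendsto (\<lambda>N. root_poly (R N X)) (fps_op B (root_poly X))"
      using *[of "root_poly X"] by (simp only: R)
    from coeffs_tendsto_imp_root_poly[OF this R(2)] show ?thesis
      by metis
  qed
  then obtain S where S: "\<And>X. fps_op B (root_poly X) = root_poly (S X)" "\<And>X. size (S X) = size X"
    by metis
  have lim': "coeffs_tendsto (\<lambda>N. root_poly (R N X)) (root_poly (S X))" for X
    using *[of "root_poly X"] by (simp only: R S)
  have "majorized (S X) (S Y)" if "majorized X Y" for X Y
  proof (rule majorized_limit[OF lim' _ lim'])
    have "majorized (R N X) (R N Y)" for N
      using spectral_isotoneD[OF A that, of N] by (simp add: R)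
    thus "\<forall>\<^sub>F N in sequentially. majorized (R N X) (R N Y)"
      by simp
  qed (simp_all only: R S)
  thus ?thesis
    unfolding spectral_isotone_def S using S(2) by auto
qed

lemma spectral_isotone_linear: "spectral_isotone (1 - fps_const a * fps_X)"
proof (cases "a = 0")
  case True
  thus ?thesis by (simp add: spectral_isotone_1)
next
  case False
  interpret first_order_op a 1
    by standard (use False in auto)
  have "fps_op (1 - fps_const a * fps_X) P = T P" for P
  proof -
    have "fps_op (1 - fps_const a * fps_X) P = fps_op (fps_X ^ 0) P - smult a (fps_op (fps_X ^ 1) P)"
      by (simp only: fps_op_def smult_sum_right sum_subtractf[symmetric] smult_diff_left smult_smult
          fps_sub_nth fps_mult_left_const_nth power_0 power_one_right)
    thus ?thesis
      unfolding fps_op_X_power by (simp add: T_def)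
  qed
  thus ?thesis
    unfolding spectral_isotone_def
    using T_root_poly majorized_roots_T by (auto simp: lead_T_def deg_T_def roots_T_def[symmetric])
qed

section \<open>Exponential factors as limits of powers\<close>

lemma tendsto_binomial_div_power: "(\<lambda>N. real (N choose k) / real N ^ k) \<longlonglongrightarrow> 1 / fact k"
proof -
  have "(\<lambda>N. (\<Prod>i=0..<k. 1 - real i / real N) / fact k) \<longlonglongrightarrow> (\<Prod>i=0..<k. 1 - 0) / fact k"
    by (intro tendsto_intros) (auto intro!: tendsto_divide_0 tendsto_const filterlim_real_sequentially
        filterlim_at_top_imp_at_infinity)
  moreover have "\<forall>\<^sub>F N in sequentially.
      (\<Prod>i=0..<k. 1 - real i / real N) / fact k = real (N choose k) / real N ^ k"
    using eventually_gt_at_top[of 0]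
  proof eventually_elim
    case (elim N)
    have "(\<Prod>i=0..<k. 1 - real i / real N) = (\<Prod>i=0..<k. (real N - real i) / real N)"
      using elim by (intro prod.cong) (auto simp: field_simps)
    also have "\<dots> = (\<Prod>i=0..<k. real N - real i) / real N ^ k"
      by (simp add: prod_dividef)
    finally show ?case
      by (simp add: binomial_gbinomial gbinomial_prod_rev)
  qed
  ultimately show ?thesis
    using Lim_transform_eventually by fastforce
qed

lemma fps_nth_one_plus_power:
  assumes "j > 0"
  shows "fps_nth ((1 + fps_const c * fps_X ^ j) ^ N) n =
     (if j dvd n then of_nat (N choose (n div j)) * (c :: real) ^ (n div j) else 0)"
proof -
  have eq: "(1 + fps_const c * fps_X ^ j) ^ N = (\<Sum>k\<le>N. fps_const (of_nat (N choose k) * c ^ k) * fps_X ^ (j * k))"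
    unfolding binomial_ring add.commute[of 1]
    by (intro sum.cong refl) (simp add: power_mult_distrib fps_const_power power_mult[symmetric]
        fps_of_nat[symmetric] mult_ac del: fps_of_nat)
  have "fps_nth ((1 + fps_const c * fps_X ^ j) ^ N) n =
      (\<Sum>k\<le>N. if n = j * k then of_nat (N choose k) * c ^ k else 0)"
    unfolding eq fps_sum_nth by (intro sum.cong refl) (simp add: fps_X_power_nth)
  also have "\<dots> = (if j dvd n then of_nat (N choose (n div j)) * c ^ (n div j) else 0)"
  proof (cases "j dvd n")
    case True
    hence "n = j * k \<longleftrightarrow> k = n div j" for k
      using assms by auto
    thus ?thesis
      using True by (auto simp: binomial_eq_0)
  next
    case False
    thus ?thesis
      by (auto intro!: sum.neutral)
  qed
  finally show ?thesis .
qed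

text \<open>The limit is the Taylor series of \<open>exp (c * x ^ j)\<close>; \<open>j = 1\<close>
  serves the factor \<open>exp (b * x)\<close> and \<open>j = 2\<close> the Gaussian one.\<close>

lemma tendsto_fps_nth_one_plus_power:
  assumes "j > 0"
  shows "(\<lambda>N. fps_nth ((1 + fps_const (c / real N) * fps_X ^ j) ^ N) n) \<longlonglongrightarrow>
     (if j dvd n then c ^ (n div j) / fact (n div j) else 0)"
proof (cases "j dvd n")
  case True
  have "(\<lambda>N. c ^ (n div j) * (real (N choose (n div j)) / real N ^ (n div j))) \<longlonglongrightarrow>
      c ^ (n div j) * (1 / fact (n div j))"
    by (intro tendsto_mult tendsto_const tendsto_binomial_div_power)
  thus ?thesis
    unfolding fps_nth_one_plus_power[OF assms] using True by (simp add: power_divide mult.commute)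
next
  case False
  thus ?thesis
    unfolding fps_nth_one_plus_power[OF assms] by simp
qed

lemma spectral_isotone_exp: "spectral_isotone (fps_exp b)"
proof (rule spectral_isotone_limit)
  show "spectral_isotone ((1 + fps_const (b / real N) * fps_X ^ 1) ^ N)" for N
    using spectral_isotone_power[OF spectral_isotone_linear[of "- b / real N"], of N]
    by (simp add: fps_const_neg[symmetric] del: fps_const_neg)
  show "(\<lambda>N. fps_nth ((1 + fps_const (b / real N) * fps_X ^ 1) ^ N) k) \<longlonglongrightarrow> fps_nth (fps_exp b) k" for k
    using tendsto_fps_nth_one_plus_power[of 1 b k] by simp
qed

definition fps_gauss :: "real \<Rightarrow> real fps" where
  "fps_gauss c = Abs_fps (\<lambda>k. if even k then c ^ (k div 2) / fact (k div 2) else 0)"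

text \<open>The negative sign is what makes \<open>1 - (a^2 / N) x^2\<close> split into the real
  factors \<open>1 - c x\<close> and \<open>1 + c x\<close>. For \<open>N = 0\<close>, division by
  zero gives \<open>c = 0\<close> and the identity still holds.\<close>

lemma spectral_isotone_gauss: "spectral_isotone (fps_gauss (- a\<^sup>2))"
proof (rule spectral_isotone_limit)
  fix N :: nat
  define c where "c = a / sqrt (real N)"
  have "c\<^sup>2 = a\<^sup>2 / real N"
    by (simp add: c_def power_divide)
  hence "1 + fps_const (- a\<^sup>2 / real N) * fps_X ^ 2 =
      (1 - fps_const c * fps_X) * (1 - fps_const (- c) * fps_X)"
    by (simp add: algebra_simps power2_eq_square fps_const_neg[symmetric] fps_const_mult[symmetric]
        del: fps_const_neg fps_const_mult)
  thus "spectral_isotone ((1 + fps_const (- a\<^sup>2 / real N) * fps_X ^ 2) ^ N)"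
    by (simp only:) (intro spectral_isotone_power spectral_isotone_mult spectral_isotone_linear)
next
  show "(\<lambda>N. fps_nth ((1 + fps_const (- a\<^sup>2 / real N) * fps_X ^ 2) ^ N) k) \<longlonglongrightarrow> fps_nth (fps_gauss (- a\<^sup>2)) k" for k
    using tendsto_fps_nth_one_plus_power[of 2 "- a\<^sup>2" k] by (simp add: fps_gauss_def)
qed

section \<open>The Laguerre-Polya class\<close>

definition fps_complex :: "real fps \<Rightarrow> complex fps" where
  "fps_complex A = Abs_fps (\<lambda>n. of_real (fps_nth A n))"

lemma fps_nth_fps_complex [simp]: "fps_nth (fps_complex A) n = of_real (fps_nth A n)"
  by (simp add: fps_complex_def)

lemma fps_complex_mult: "fps_complex (A * B) = fps_complex A * fps_complex B"
  by (rule fps_ext) (simp add: fps_mult_nth)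

lemma fps_complex_1: "fps_complex 1 = 1"
  by (rule fps_ext) simp

lemma fps_complex_prod: "fps_complex (\<Prod>i\<in>I. A i) = (\<Prod>i\<in>I. fps_complex (A i))"
  by (induction I rule: infinite_finite_induct) (simp_all add: fps_complex_mult fps_complex_1)

lemma fps_complex_linear: "fps_complex (1 - fps_const a * fps_X) = 1 - fps_const (of_real a) * fps_X"
  by (rule fps_ext) (simp add: fps_X_def)

lemma fps_complex_exp: "fps_complex (fps_exp a) = fps_exp (of_real a)"
  by (rule fps_ext) simp

lemma fps_complex_const: "fps_complex (fps_const c) = fps_const (of_real c)"
  by (rule fps_ext) simp

lemma fps_complex_X_power: "fps_complex (fps_X ^ m) = fps_X ^ m"
  by (rule fps_ext) (simp add: fps_X_power_nth)

lemma has_fps_expansion_gauss: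
  "(\<lambda>z. exp (of_real c * z\<^sup>2)) has_fps_expansion fps_complex (fps_gauss c)"
proof (rule has_fps_expansionI, rule always_eventually, rule allI)
  fix z :: complex
  let ?f = "\<lambda>n. fps_nth (fps_complex (fps_gauss c)) n * z ^ n"
  have "(\<lambda>n. (of_real c * z\<^sup>2) ^ n /\<^sub>R fact n) sums exp (of_real c * z\<^sup>2)"
    by (rule exp_converges)
  also have "(\<lambda>n. (of_real c * z\<^sup>2) ^ n /\<^sub>R fact n) = (\<lambda>n. ?f (2 * n))"
  proof
    fix n
    have "(z\<^sup>2) ^ n = z ^ (2 * n)"
      by (simp only: power_mult)
    thus "(of_real c * z\<^sup>2) ^ n /\<^sub>R fact n = ?f (2 * n)"
      by (simp only: power_mult_distrib) (simp add: fps_gauss_def scaleR_conv_of_real divide_inverse)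
  qed
  finally show "?f sums exp (of_real c * z\<^sup>2)"
    by (subst (asm) sums_mono_reindex) (auto simp: strict_mono_def fps_gauss_def elim!: evenE)
qed

section \<open>The infinite product\<close>

context
  fixes \<alpha> :: "nat \<Rightarrow> real"
  assumes \<alpha>: "summable (\<lambda>k. (\<alpha> k)\<^sup>2)"
begin

definition genus1_prod :: "complex \<Rightarrow> complex" where
  "genus1_prod z = (\<Prod>k. (1 - of_real (\<alpha> k) * z) * exp (of_real (\<alpha> k) * z))"

definition genus1_partial_prod :: "nat \<Rightarrow> complex \<Rightarrow> complex" where
  "genus1_partial_prod N z = (\<Prod>k<N. (1 - of_real (\<alpha> k) * z) * exp (of_real (\<alpha> k) * z))"

text \<open>The exponential cancels the linear term, leaving an error of second order, which is why
  square summability suffices. The bound for Weierstrass factors asks for an argument of norm at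
  most 1/2, available on the unit disc once \<open>\<alpha> k\<close> is small; only a neighbourhood
  of 0 matters later.\<close>

lemma genus1_factor_bound:
  "\<forall>\<^sub>F k in sequentially. \<forall>z\<in>cball (0::complex) 1.
     norm ((1 - of_real (\<alpha> k) * z) * exp (of_real (\<alpha> k) * z) - 1) \<le> 3 * (\<alpha> k)\<^sup>2"
proof -
  have "(\<lambda>k. (\<alpha> k)\<^sup>2) \<longlonglongrightarrow> 0"
    using \<alpha> by (rule summable_LIMSEQ_zero)
  hence "\<forall>\<^sub>F k in sequentially. (\<alpha> k)\<^sup>2 < (1 / 2)\<^sup>2"
    by (rule order_tendstoD) simp
  thus ?thesis
  proof eventually_elim
    case (elim k)
    hence "\<bar>\<alpha> k\<bar>\<^sup>2 < (1 / 2)\<^sup>2"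
      by simp
    hence \<alpha>k: "\<bar>\<alpha> k\<bar> < 1 / 2"
      by (rule power_less_imp_less_base) simp
    show ?case
    proof
      fix z :: complex assume "z \<in> cball 0 1"
      hence z: "norm z \<le> 1"
        by simp
      have le: "norm (of_real (\<alpha> k) * z) \<le> \<bar>\<alpha> k\<bar>"
        using mult_left_mono[OF z, of "\<bar>\<alpha> k\<bar>"] by (simp add: norm_mult)
      have "norm (weierstrass_factor 1 (of_real (\<alpha> k) * z) - 1) \<le> 3 * norm (of_real (\<alpha> k) * z) ^ Suc 1"
        using le \<alpha>k by (intro weierstrass_factor_bound) linarith
      also have "\<dots> \<le> 3 * \<bar>\<alpha> k\<bar> ^ Suc 1"
        using le by (intro mult_left_mono power_mono) auto
      finally show "norm ((1 - of_real (\<alpha> k) * z) * exp (of_real (\<alpha> k) * z) - 1) \<le> 3 * (\<alpha> k)\<^sup>2"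
        by (simp add: weierstrass_factor_def numeral_2_eq_2 del: power_Suc) (simp add: power2_eq_square)
    qed
  qed
qed

lemma uniform_limit_genus1_prod:
  "uniform_limit (cball 0 1) genus1_partial_prod genus1_prod sequentially"
proof -
  let ?f = "\<lambda>k z. (1 - of_real (\<alpha> k) * z) * exp (of_real (\<alpha> k) * z) :: complex"
  have sum: "summable (\<lambda>k. 3 * (\<alpha> k)\<^sup>2)"
    by (intro summable_mult \<alpha>)
  have "uniformly_convergent_on (cball 0 1) (\<lambda>N z. \<Prod>k<N. ?f k z)"
  proof (rule uniformly_convergent_on_prod')
    show "uniformly_convergent_on (cball 0 1) (\<lambda>N z. \<Sum>k<N. norm (?f k z - 1))"
      by (rule Weierstrass_m_test'_ev[OF _ sum]) (use genus1_factor_bound in simp)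
  qed (auto intro!: continuous_intros)
  then obtain g where g: "uniform_limit (cball 0 1) genus1_partial_prod g sequentially"
    unfolding uniformly_convergent_on_def genus1_partial_prod_def by blast
  \<comment> \<open>The uniform limit \<open>g\<close> is identified with the infinite product
    pointwise, through absolute convergence.\<close>
  also have "?this \<longleftrightarrow> ?thesis"
  proof (intro uniform_limit_cong always_eventually ballI allI refl)
    fix z :: complex assume z: "z \<in> cball 0 1"
    have "\<forall>\<^sub>F k in sequentially. norm (norm (?f k z - 1)) \<le> 3 * (\<alpha> k)\<^sup>2"
      using genus1_factor_bound by eventually_elim (use z in auto)
    hence "summable (\<lambda>k. norm (?f k z - 1))"
      by (rule summable_comparison_test_ev[OF _ sum])
    hence "convergent_prod (\<lambda>k. ?f k z)"
      by (intro abs_convergent_prod_imp_convergent_prod)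
         (simp add: abs_convergent_prod_conv_summable)
    hence "(\<lambda>N. genus1_partial_prod (Suc N) z) \<longlonglongrightarrow> genus1_prod z"
      unfolding genus1_partial_prod_def genus1_prod_def lessThan_Suc_atMost by (rule convergent_prod_LIMSEQ)
    moreover have "(\<lambda>N. genus1_partial_prod (Suc N) z) \<longlonglongrightarrow> g z"
      by (rule LIMSEQ_Suc[OF tendsto_uniform_limitI[OF g z]])
    ultimately show "g z = genus1_prod z"
      by (rule LIMSEQ_unique[symmetric])
  qed
  finally show ?thesis .
qed

lemma genus1_partial_prod_holomorphic: "genus1_partial_prod N holomorphic_on A"
  unfolding genus1_partial_prod_def by (intro holomorphic_intros)

lemma genus1_prod_holomorphic: "genus1_prod holomorphic_on ball 0 1"
  by (rule holomorphic_uniform_limit[OF _ uniform_limit_genus1_prod, THEN conjunct2])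
     (auto intro!: always_eventually holomorphic_on_imp_continuous_on genus1_partial_prod_holomorphic)

text \<open>Uniform convergence of holomorphic functions carries over to all derivatives at 0, so
  the Taylor series of the partial products, which are spectrally isotone, converge
  coefficientwise.\<close>

lemma genus1_prod_fps_expansion:
  obtains A where "genus1_prod has_fps_expansion fps_complex A" "spectral_isotone A"
proof -
  define Q where "Q N = (\<Prod>k<N. (1 - fps_const (\<alpha> k) * fps_X) * fps_exp (\<alpha> k))" for N
  define d where "d k = (deriv ^^ k) genus1_prod 0 / fact k" for k
  \<comment> \<open>The real part only provides a real series; as limits of real coefficients the
    \<open>d k\<close> are themselves real.\<close>
  define A where "A = Abs_fps (\<lambda>k. Re (d k))"
  have "genus1_partial_prod N has_fps_expansion fps_complex (Q N)" for N
    unfolding genus1_partial_prod_def Q_def fps_complex_prod fps_complex_mult fps_complex_linear fps_complex_exp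
    by (intro fps_expansion_intros)
  hence Q: "of_real (fps_nth (Q N) k) = (deriv ^^ k) (genus1_partial_prod N) 0 / fact k" for N k
    using fps_nth_fps_expansion by fastforce
  have "uniform_limit (ball 0 1) genus1_partial_prod genus1_prod sequentially"
    by (rule uniform_limit_on_subset[OF uniform_limit_genus1_prod]) auto
  hence "(\<lambda>N. (deriv ^^ k) (genus1_partial_prod N) 0) \<longlonglongrightarrow> (deriv ^^ k) genus1_prod 0" for k
    by (rule higher_deriv_complex_uniform_limit) (auto intro!: always_eventually genus1_partial_prod_holomorphic)
  hence lim: "(\<lambda>N. complex_of_real (fps_nth (Q N) k)) \<longlonglongrightarrow> d k" for k
    unfolding Q d_def by (intro tendsto_divide tendsto_const) auto
  have limA: "(\<lambda>N. fps_nth (Q N) k) \<longlonglongrightarrow> fps_nth A k" for k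
    using tendsto_Re[OF lim[of k]] by (simp add: A_def)
  have "of_real (fps_nth A k) = d k" for k
    using tendsto_of_real[OF limA[of k]] lim[of k] LIMSEQ_unique by blast
  hence "fps_complex A = fps_expansion genus1_prod 0"
    by (intro fps_ext) (simp add: fps_expansion_def d_def)
  moreover have "genus1_prod has_fps_expansion fps_expansion genus1_prod 0"
    by (rule has_fps_expansion_fps_expansion[OF _ _ genus1_prod_holomorphic]) auto
  moreover have "spectral_isotone A"
  proof (rule spectral_isotone_limit[OF _ limA])
    show "spectral_isotone (Q N)" for N
      unfolding Q_def
      by (intro spectral_isotone_prod spectral_isotone_mult spectral_isotone_linear spectral_isotone_exp)
  qed
  ultimately show thesis
    by (intro that[of A]) simp_all
qed

lemma genus1_prod_0: "genus1_prod 0 = 1"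
  by (simp add: genus1_prod_def)

end

text \<open>The exponent in the product representation is given only existentially; the remaining
  factor does not vanish at 0, so \<open>zorder\<close> identifies it with \<open>m\<close>. The
  factor \<open>c x^m\<close> is split off because isotone series preserve degree and leading
  coefficient.\<close>

lemma laguerre_polya_ord_imp_fps:
  assumes "\<phi> \<in> laguerre_polya_ord m"
  obtains c A where "c \<noteq> 0" "spectral_isotone A"
    "\<And>k. real_deriv0 \<phi> k / fact k = fps_nth (fps_const c * (fps_X ^ m * A)) k"
proof -
  obtain a b c m' \<alpha> where c: "c \<noteq> 0" and \<alpha>: "summable (\<lambda>k. (\<alpha> k)\<^sup>2)"
    and \<phi>: "\<And>z. \<phi> z = of_real c * z ^ m' * exp (- of_real (a\<^sup>2) * z\<^sup>2 + of_real b * z) *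
               (\<Prod>k. (1 - of_real (\<alpha> k) * z) * exp (of_real (\<alpha> k) * z))"
    and zorder: "zorder \<phi> 0 = int m"
    using assms unfolding laguerre_polya_ord_def laguerre_polya_def by blast
  define h where "h z = exp (- of_real (a\<^sup>2) * z\<^sup>2) * exp (of_real b * z) * genus1_prod \<alpha> z" for z :: complex
  have \<phi>_eq: "\<phi> z = of_real c * (z ^ m' * h z)" for z
    unfolding \<phi> h_def genus1_prod_def[OF \<alpha>] exp_add by (simp add: mult_ac)
  have "zorder \<phi> 0 = int m'"
  proof (rule zorder_eqI)
    show "(\<lambda>z. of_real c * h z) holomorphic_on ball 0 1"
      unfolding h_def by (intro holomorphic_intros genus1_prod_holomorphic \<alpha>)
    show "of_real c * h 0 \<noteq> 0"
      using c by (simp add: h_def genus1_prod_0[OF \<alpha>])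
  qed (auto simp: \<phi>_eq)
  hence m': "m' = m"
    using zorder by simp
  obtain B where B: "genus1_prod \<alpha> has_fps_expansion fps_complex B" "spectral_isotone B"
    using genus1_prod_fps_expansion[OF \<alpha>] .
  define A where "A = fps_gauss (- a\<^sup>2) * fps_exp b * B"
  have "(\<lambda>z. exp (of_real (- a\<^sup>2) * z\<^sup>2)) has_fps_expansion fps_complex (fps_gauss (- a\<^sup>2))"
    by (rule has_fps_expansion_gauss)
  hence "h has_fps_expansion fps_complex A"
    unfolding h_def A_def fps_complex_mult fps_complex_exp
    by (intro fps_expansion_intros B) simp
  hence "(\<lambda>z. of_real c * (z ^ m * h z)) has_fps_expansion fps_complex (fps_const c * (fps_X ^ m * A))"
    unfolding fps_complex_mult fps_complex_const fps_complex_X_power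
    by (intro fps_expansion_intros)
  hence "\<phi> has_fps_expansion fps_complex (fps_const c * (fps_X ^ m * A))"
    using \<phi>_eq m' by presburger
  from fps_nth_fps_expansion[OF this]
  have *: "(deriv ^^ k) \<phi> 0 / fact k = of_real (fps_nth (fps_const c * (fps_X ^ m * A)) k)" for k
    by simp
  have "real_deriv0 \<phi> k / fact k = fps_nth (fps_const c * (fps_X ^ m * A)) k" for k
  proof -
    let ?r = "fps_nth (fps_const c * (fps_X ^ m * A)) k"
    have "(deriv ^^ k) \<phi> 0 = of_real (fact k * ?r)"
      using *[of k] by (simp add: field_simps del: fps_mult_left_const_nth)
    hence "real_deriv0 \<phi> k = fact k * ?r"
      unfolding real_deriv0_def by (simp only: Re_complex_of_real)
    thus ?thesis
      by simp
  qed
  moreover have "spectral_isotone A"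
    unfolding A_def by (intro spectral_isotone_mult spectral_isotone_gauss spectral_isotone_exp B)
  ultimately show thesis
    using that c by blast
qed

section \<open>Iterated differentiation and the normalized operator\<close>

interpretation pderiv: first_order_op "-1" 0
  by standard auto

lemma pderiv_T: "pderiv.T p = pderiv p"
  by (simp add: pderiv.T_def)

text \<open>The scalar is the falling factorial of length \<open>m\<close> starting at
  \<open>size X\<close>, later cancelled by \<open>norm_const\<close>.\<close>

lemma funpow_pderiv_root_poly:
  assumes "m \<le> size X"
  obtains Z where "(pderiv ^^ m) (root_poly X) = smult (fact (size X) / fact (size X - m)) (root_poly Z)"
    "size Z = size X - m"
proof -
  have "\<exists>Z. (pderiv ^^ m) (root_poly X) = smult (fact (size X) / fact (size X - m)) (root_poly Z) \<and>
      size Z = size X - m"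
    using assms
  proof (induction m)
    case (Suc m)
    then obtain Z where Z: "(pderiv ^^ m) (root_poly X) = smult (fact (size X) / fact (size X - m)) (root_poly Z)"
      "size Z = size X - m"
      by auto
    have nz: "(0::real) \<noteq> 0 \<or> Z \<noteq> {#}"
      using Suc.prems Z(2) by auto
    have "fact (size X - m) = real (size X - m) * fact (size X - Suc m)"
      using Suc.prems by (subst fact_reduce) auto
    hence "fact (size X) / fact (size X - m) * real (size X - m) = fact (size X) / fact (size X - Suc m)"
      using Suc.prems by simp
    moreover have "pderiv (root_poly Z) = smult (real (size X - m)) (root_poly (pderiv.roots_T Z))"
      using pderiv.T_root_poly(1)[OF nz] by (simp add: pderiv_T pderiv.lead_T_def Z(2))
    moreover have "size (pderiv.roots_T Z) = size X - Suc m"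
      using pderiv.T_root_poly(2)[OF nz] by (simp add: pderiv.deg_T_def Z(2))
    ultimately show ?case
      by (intro exI[of _ "pderiv.roots_T Z"]) (simp add: Z(1) pderiv_smult)
  qed auto
  thus thesis
    using that by blast
qed

lemma majorized_funpow_pderiv:
  assumes "majorized X Y" "m \<le> size X"
  shows   "majorized (proots ((pderiv ^^ m) (root_poly X))) (proots ((pderiv ^^ m) (root_poly Y)))"
  using assms(2)
proof (induction m)
  case 0
  thus ?case using assms(1) by simp
next
  case (Suc m)
  have sz: "size Y = size X"
    using assms(1) by (simp add: majorized_size)
  define c :: real where "c = fact (size X) / fact (size X - m)"
  have c: "c \<noteq> 0"
    by (simp add: c_def)
  obtain Z where Z: "(pderiv ^^ m) (root_poly X) = smult c (root_poly Z)"
    using funpow_pderiv_root_poly[of m X] Suc.prems unfolding c_def by auto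
  obtain W where W: "(pderiv ^^ m) (root_poly Y) = smult c (root_poly W)"
    using funpow_pderiv_root_poly[of m Y] Suc.prems sz unfolding c_def by auto
  have "majorized Z W"
    using Suc c by (simp add: Z W)
  hence "majorized (pderiv.roots_T Z) (pderiv.roots_T W)"
    by (rule pderiv.majorized_roots_T)
  thus ?case
    using c by (simp add: Z W pderiv_smult pderiv.roots_T_def pderiv_T)
qed

text \<open>Jensen's inequality through a supporting line at 0, whose linear term drops out because
  the sum is 0.\<close>

lemma majorized_replicate_mean:
  assumes "\<Sum>\<^sub># X = 0"
  shows   "majorized (replicate_mset (size X) 0) X"
  unfolding majorized_def
proof (intro conjI allI impI)
  fix f :: "real \<Rightarrow> real" assume "convex_on UNIV f"
  then obtain s where s: "\<And>y. f 0 + s * (y - 0) \<le> f y"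
    using convex_supporting_line by blast
  have "0 \<le> (\<Sum>x\<in>#X. f x - (f 0 + s * (x - 0)))"
    using s by (induction X) auto
  thus "(\<Sum>x\<in>#replicate_mset (size X) 0. f x) \<le> (\<Sum>y\<in>#X. f y)"
    using assms by (simp only: sum_mset_affine) simp
qed simp

lemma norm_diff_op_root_poly:
  assumes \<phi>: "\<phi> \<in> laguerre_polya_ord m" and n: "m < n"
  obtains R where
    "\<And>X. size X = n \<Longrightarrow> norm_diff_op m n \<phi> (root_poly X) = root_poly (R X)"
    "\<And>X. size X = n \<Longrightarrow> size (R X) = n - m"
    "\<And>X Y. size X = n \<Longrightarrow> majorized X Y \<Longrightarrow> majorized (R X) (R Y)"
proof -
  obtain c A where c: "c \<noteq> 0" and A: "spectral_isotone A"
    and \<phi>_nth: "\<And>k. real_deriv0 \<phi> k / fact k = fps_nth (fps_const c * (fps_X ^ m * A)) k"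
    using laguerre_polya_ord_imp_fps[OF \<phi>] by blast
  have diff_op: "diff_op \<phi> P = smult c ((pderiv ^^ m) (fps_op A P))" for P
  proof -
    have "diff_op \<phi> P = fps_op (fps_const c * (fps_X ^ m * A)) P"
      unfolding diff_op_def fps_op_def \<phi>_nth ..
    thus ?thesis
      unfolding fps_op_smult by (simp only: fps_op_mult fps_op_X_power)
  qed
  \<comment> \<open>The image of the constant polynomial 1 is again monic of degree 0, which pins
    down the constant term; so \<open>c\<close> is the coefficient of \<open>x^m\<close> in
    \<open>\<phi>\<close>.\<close>
  have "fps_nth A 0 = 1"
  proof -
    obtain Y where "fps_op A (root_poly {#}) = root_poly Y" "size Y = size ({#} :: real multiset)"
      using spectral_isotoneE[OF A] .
    thus ?thesis
      by (simp add: fps_op_def one_pCons)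
  qed
  hence "fps_nth (fps_const c * (fps_X ^ m * A)) m = c"
    unfolding fps_mult_left_const_nth fps_X_power_mult_nth by simp
  hence "real_deriv0 \<phi> m / fact m = c"
    unfolding \<phi>_nth .
  hence "real_deriv0 \<phi> m = fact m * c"
    by (simp add: field_simps)
  \<comment> \<open>The product of \<open>n choose m\<close> and \<open>fact m\<close> is the
    falling factorial produced by \<open>m\<close> differentiations, so exactly this factor and
    \<open>c\<close> cancel.\<close>
  hence norm: "norm_const m n \<phi> * c * (fact n / fact (n - m)) = 1"
    using c n by (simp add: norm_const_def binomial_fact field_simps)
  define k :: real where "k = fact n / fact (n - m)"
  have k: "k \<noteq> 0"
    by (simp add: k_def)
  define R where "R X = proots ((pderiv ^^ m) (fps_op A (root_poly X)))" for X
  have R: "norm_diff_op m n \<phi> (root_poly X) = root_poly (R X) \<and> size (R X) = n - m"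
    if X: "size X = n" for X
  proof -
    obtain Y where Y: "fps_op A (root_poly X) = root_poly Y" "size Y = n"
      using spectral_isotoneE[OF A, of X] X by metis
    obtain Z where Z: "(pderiv ^^ m) (root_poly Y) = smult k (root_poly Z)" "size Z = n - m"
      using funpow_pderiv_root_poly[of m Y] Y(2) n unfolding k_def by auto
    have "R X = Z"
      using k by (simp add: R_def Y Z)
    moreover have "norm_diff_op m n \<phi> (root_poly X) = root_poly Z"
      using norm by (simp add: norm_diff_op_def diff_op Y Z k_def[symmetric] mult.assoc)
    ultimately show ?thesis
      using Z(2) by simp
  qed
  have "majorized (R X) (R Y)" if X: "size X = n" and maj: "majorized X Y" for X Y
  proof -
    obtain X' where X': "fps_op A (root_poly X) = root_poly X'" "size X' = size X"
      using spectral_isotoneE[OF A] .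
    obtain Y' where Y': "fps_op A (root_poly Y) = root_poly Y'" "size Y' = size Y"
      using spectral_isotoneE[OF A] .
    have "majorized X' Y'"
      using spectral_isotoneD[OF A maj] by (simp add: X' Y')
    thus ?thesis
      unfolding R_def X' Y' by (rule majorized_funpow_pderiv) (use X' X n in simp)
  qed
  with R show thesis
    using that by blast
qed

theorem corollary3:
  fixes m n :: nat and \<phi> :: "complex \<Rightarrow> complex"
  assumes "\<phi> \<in> laguerre_polya_ord m"
    and "n \<ge> m + 1"
  shows "smult (norm_const m n \<phi>) (appell \<phi> n) \<in> norm_diff_op m n \<phi> ` hyp_polys0 n
    \<and> (\<forall>R \<in> norm_diff_op m n \<phi> ` hyp_polys0 n.
         spectral_le (n - m) (smult (norm_const m n \<phi>) (appell \<phi> n)) R)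
    \<and> (\<forall>Q \<in> norm_diff_op m n \<phi> ` hyp_polys0 n.
         (\<forall>R \<in> norm_diff_op m n \<phi> ` hyp_polys0 n. spectral_le (n - m) Q R) \<longrightarrow>
           Q = smult (norm_const m n \<phi>) (appell \<phi> n))"
proof -
  let ?O = "replicate_mset n (0 :: real)"
  let ?S = "norm_diff_op m n \<phi> ` hyp_polys0 n"
  obtain R where R: "\<And>X. size X = n \<Longrightarrow> norm_diff_op m n \<phi> (root_poly X) = root_poly (R X)"
    "\<And>X. size X = n \<Longrightarrow> size (R X) = n - m"
    "\<And>X Y. size X = n \<Longrightarrow> majorized X Y \<Longrightarrow> majorized (R X) (R Y)"
    using norm_diff_op_root_poly[OF assms(1), of n] assms(2) by auto
  have hyp0: "hyp_polys0 n = {root_poly X |X. size X = n \<and> \<Sum>\<^sub># X = 0}"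
  proof (intro equalityI subsetI)
    fix P assume P: "P \<in> hyp_polys0 n"
    then obtain X where X: "P = root_poly X" "size X = n"
      unfolding hyp_polys0_def by (auto elim: hyp_polys_imp_root_poly)
    have "\<Sum>\<^sub># X = 0"
      using P assms(2) by (simp add: hyp_polys0_def X)
    thus "P \<in> {root_poly X |X. size X = n \<and> \<Sum>\<^sub># X = 0}"
      using X by blast
  next
    fix P assume "P \<in> {root_poly X |X. size X = n \<and> \<Sum>\<^sub># X = 0}"
    thus "P \<in> hyp_polys0 n"
      using root_poly_in_hyp_polys by (auto simp: hyp_polys0_def)
  qed
  hence S: "?S = {root_poly (R X) |X. size X = n \<and> \<Sum>\<^sub># X = 0}"
    using R(1) by (auto simp: image_iff) metis+
  \<comment> \<open>The Appell polynomial is thus the image of an admissible polynomial, the one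
    with all roots at the mean.\<close>
  have "root_poly ?O = monom 1 n"
    by (induction n) (simp_all add: monom_Suc)
  hence G: "smult (norm_const m n \<phi>) (appell \<phi> n) = root_poly (R ?O)"
    using R(1)[of ?O] by (simp add: norm_diff_op_def appell_def)
  have mem: "root_poly (R ?O) \<in> ?S"
    unfolding S by (intro CollectI exI[of _ ?O]) simp
  have le: "spectral_le (n - m) (root_poly (R ?O)) Q" if "Q \<in> ?S" for Q
  proof -
    from that obtain X where X: "Q = root_poly (R X)" "size X = n" "\<Sum>\<^sub># X = 0"
      unfolding S by blast
    have "majorized (R ?O) (R X)"
      using majorized_replicate_mean[OF X(3)] X(2) by (intro R(3)) auto
    thus ?thesis
      using root_poly_in_hyp_polys[of "R ?O"] root_poly_in_hyp_polys[of "R X"] R(2)[of ?O] R(2)[of X] X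
      by (simp add: spectral_le_def)
  qed
  \<comment> \<open>Two minima have root multisets that majorize each other; hinge sums recover a
    multiset, so they coincide.\<close>
  have "Q = root_poly (R ?O)" if Q: "Q \<in> ?S" and min: "\<forall>R\<in>?S. spectral_le (n - m) Q R" for Q
  proof -
    obtain X where X: "Q = root_poly (R X)"
      using Q unfolding S by blast
    have "majorized (R X) (R ?O)" "majorized (R ?O) (R X)"
      using bspec[OF min mem] le[OF Q] by (simp_all add: spectral_le_def X)
    thus ?thesis
      using majorized_antisym X by metis
  qed
  thus ?thesis
    unfolding G using mem le by blast
qed

end
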